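(* Let $n\in\mathbb N$ and let $\mu$ be a positive Borel measure on $T_\Omega$. The following conditions are equivalent. (i) $\mu$ is a Carleson measure for $H^n_{2,\rho}(T_\Omega)$; (ii) the embedding $J_\mu:H^n_{2,\rho}(T_\Omega)\to L^2(T_\Omega,\mu)$, $J_\mu(F)=F$, is (well defined and) bounded; (iii) the sesquilinear form $$B_\mu(F,G):=\int_{T_\Omega}F(z)\overline{G(z)}\,d\mu(z)$$ is bounded on $H^n_{2,\rho}(T_\Omega)\times H^n_{2,\rho}(T_\Omega)$; (iv) there exists a unique bounded positive operator $T_\mu:H^n_{2,\rho}(T_\Omega)\to H^n_{2,\rho}(T_\Omega)$ such that $$\langle T_\mu F,G\rangle_{H^n_{2,\rho}(T_\Omega)}=B_\mu(F,G)$$ for all $F,G\in H^n_{2,\rho}(T_\Omega)$.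
   Context: Let $d\ge 1$ and let $\Omega\subset\mathbb R^d$ be a nonempty open convex cone containing no complete straight line. Its dual cone is $\Omega^\ast=\{\xi\in\mathbb R^d:\langle x,\xi\rangle\ge 0\text{ for all }x\in\Omega\}$, and $T_\Omega=\mathbb R^d+i\Omega\subset\mathbb C^d$ is the associated tube domain. For $z\in\mathbb C^d$, $\xi\in\mathbb R^d$, $\langle z,\xi\rangle=\sum_{j=1}^d z_j\xi_j$ (bilinear). Fix a continuous function $\rho:\Omega^\ast\to[0,\infty)$ with $\rho(\xi)>0$ for $\xi\ne 0$ and $\rho(t\xi)=t\rho(\xi)$ for all $t>0$, $\xi\in\Omega^\ast$ (so $\rho(0)=0$). For $n\in\mathbb N$ let $w_n(\xi)=\sum_{k=0}^n\rho(\xi)^{2k}$, and let $L^2(\Omega^\ast,w_n)$ be the space of (classes of) measurable complex functions $f$ on $\Omega^\ast$ with $\|f\|_{L^2(\Omega^\ast,w_n)}^2=\int_{\Omega^\ast}|f|^2w_n\,d\xi<\infty$. The Hilbertian Hardy--Sobolev space $H^n_{2,\rho}(T_\Omega)$ consists of all holomorphic functions on $T_\Omega$ of the form $\mathcal Lf(z)=\int_{\Omega^\ast}e^{i\langle z,\xi\rangle}f(\xi)\,d\xi$ with $f\in L^2(\Omega^\ast,w_n)$. The map $\mathcal L$ is injective on $L^2(\Omega^\ast,w_n)$, and $H^n_{2,\rho}(T_\Omega)$ is a Hilbert space with inner product $\langle\mathcal Lf,\mathcal Lg\rangle_{H^n_{2,\rho}(T_\Omega)}=\int_{\Omega^\ast}f\overline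 g\,w_n\,d\xi$. A positive Borel measure $\mu$ on $T_\Omega$ is a Carleson measure for $H^n_{2,\rho}(T_\Omega)$ if there is $C>0$ with $\int_{T_\Omega}|F|^2\,d\mu\le C\|F\|^2_{H^n_{2,\rho}(T_\Omega)}$ for all $F\in H^n_{2,\rho}(T_\Omega)$. In (iii) and (iv) it is understood that the integral defining $B_\mu(F,G)$ converges absolutely for all $F,G\in H^n_{2,\rho}(T_\Omega)$; boundedness of $B_\mu$ means $|B_\mu(F,G)|\le C\|F\|\,\|G\|$ for some constant $C$ and all $F,G$. *)

theory Defs
  imports "HOL-Analysis.Analysis"
begin

definition dual_cone :: "(real^'d) set \<Rightarrow> (real^'d) set" where
  "dual_cone \<Omega> = {\<xi>. \<forall>x\<in>\<Omega>. 0 \<le> x \<bullet> \<xi>}"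

definition tube :: "(real^'d) set \<Rightarrow> (complex^'d) set" where
  "tube \<Omega> = {z. (\<chi> j. Im (z $ j)) \<in> \<Omega>}"

definition bilin :: "complex^'d \<Rightarrow> real^'d \<Rightarrow> complex" where
  "bilin z \<xi> = (\<Sum>j\<in>UNIV. z $ j * of_real (\<xi> $ j))"

text \<open>Holomorphy in several variables on an open set: the real Frechet derivative exists
  and is complex linear.\<close>

definition holomorphic_several :: "(complex^'d \<Rightarrow> complex) \<Rightarrow> (complex^'d) set \<Rightarrow> bool" where
  "holomorphic_several F S \<longleftrightarrow>
     (\<forall>z\<in>S. \<exists>D. (F has_derivative D) (at z) \<and> (\<forall>c v. D (c *s v) = c * D v))"

definition weight :: "(real^'d \<Rightarrow> real) \<Rightarrow> nat \<Rightarrow> real^'d \<Rightarrow> real" where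
  "weight \<rho> n \<xi> = (\<Sum>k=0..n. \<rho> \<xi> ^ (2 * k))"

text \<open>The \<open>L\<^sup>2\<close> spaces consist of functions rather than of classes modulo almost
  everywhere equality.\<close>

definition L2_weighted ::
    "(real^'d) set \<Rightarrow> (real^'d \<Rightarrow> real) \<Rightarrow> nat \<Rightarrow> (real^'d \<Rightarrow> complex) set" where
  "L2_weighted \<Omega> \<rho> n =
     {f \<in> borel_measurable (lebesgue_on (dual_cone \<Omega>)).
        integrable (lebesgue_on (dual_cone \<Omega>)) (\<lambda>\<xi>. (cmod (f \<xi>))\<^sup>2 * weight \<rho> n \<xi>)}"

definition L2_space :: "'a measure \<Rightarrow> ('a \<Rightarrow> complex) set" where
  "L2_space M = {f \<in> borel_measurable M. integrable M (\<lambda>x. (cmod (f x))\<^sup>2)}"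

definition L2_norm :: "'a measure \<Rightarrow> ('a \<Rightarrow> complex) \<Rightarrow> real" where
  "L2_norm M f = sqrt (LINT x|M. (cmod (f x))\<^sup>2)"

text \<open>A function on the tube is represented by its extension by zero, so that equality of
  functions in HOL is equality on the tube.\<close>

definition laplace :: "(real^'d) set \<Rightarrow> (real^'d \<Rightarrow> complex) \<Rightarrow> complex^'d \<Rightarrow> complex" where
  "laplace \<Omega> f z =
     (if z \<in> tube \<Omega>
      then LINT \<xi>|lebesgue_on (dual_cone \<Omega>). exp (\<i> * bilin z \<xi>) * f \<xi> else 0)"

definition hardy_sobolev ::
    "(real^'d) set \<Rightarrow> (real^'d \<Rightarrow> real) \<Rightarrow> nat \<Rightarrow> (complex^'d \<Rightarrow> complex) set" where
  "hardy_sobolev \<Omega> \<rho> n =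
     {F. holomorphic_several F (tube \<Omega>) \<and> (\<exists>f\<in>L2_weighted \<Omega> \<rho> n. F = laplace \<Omega> f)}"

text \<open>A preimage under the Laplace transform. By injectivity it is determined up to a null
  set, so the inner product below does not depend on the choice.\<close>

definition laplace_inv ::
    "(real^'d) set \<Rightarrow> (real^'d \<Rightarrow> real) \<Rightarrow> nat \<Rightarrow> (complex^'d \<Rightarrow> complex) \<Rightarrow> real^'d \<Rightarrow> complex" where
  "laplace_inv \<Omega> \<rho> n F = (SOME f. f \<in> L2_weighted \<Omega> \<rho> n \<and> F = laplace \<Omega> f)"

definition hs_inner ::
    "(real^'d) set \<Rightarrow> (real^'d \<Rightarrow> real) \<Rightarrow> nat
      \<Rightarrow> (complex^'d \<Rightarrow> complex) \<Rightarrow> (complex^'d \<Rightarrow> complex) \<Rightarrow> complex" where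
  "hs_inner \<Omega> \<rho> n F G =
     (LINT \<xi>|lebesgue_on (dual_cone \<Omega>).
        laplace_inv \<Omega> \<rho> n F \<xi> * cnj (laplace_inv \<Omega> \<rho> n G \<xi>) * of_real (weight \<rho> n \<xi>))"

definition hs_norm ::
    "(real^'d) set \<Rightarrow> (real^'d \<Rightarrow> real) \<Rightarrow> nat \<Rightarrow> (complex^'d \<Rightarrow> complex) \<Rightarrow> real" where
  "hs_norm \<Omega> \<rho> n F = sqrt (Re (hs_inner \<Omega> \<rho> n F F))"

definition carleson ::
    "(real^'d) set \<Rightarrow> (real^'d \<Rightarrow> real) \<Rightarrow> nat \<Rightarrow> (complex^'d) measure \<Rightarrow> bool" where
  "carleson \<Omega> \<rho> n \<mu> \<longleftrightarrow>
     (\<exists>C>0. \<forall>F\<in>hardy_sobolev \<Omega> \<rho> n.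
        (\<integral>\<^sup>+z. ennreal ((cmod (F z))\<^sup>2) \<partial>\<mu>) \<le> ennreal (C * (hs_norm \<Omega> \<rho> n F)\<^sup>2))"

text \<open>Bounded linear maps between linear spaces \<open>V\<close>, \<open>W\<close> of functions, equipped with
  (semi)norms \<open>p\<close>, \<open>q\<close>.\<close>

definition bounded_operator ::
    "('a \<Rightarrow> complex) set \<Rightarrow> (('a \<Rightarrow> complex) \<Rightarrow> real)
      \<Rightarrow> ('b \<Rightarrow> complex) set \<Rightarrow> (('b \<Rightarrow> complex) \<Rightarrow> real)
      \<Rightarrow> (('a \<Rightarrow> complex) \<Rightarrow> ('b \<Rightarrow> complex)) \<Rightarrow> bool" where
  "bounded_operator V p W q T \<longleftrightarrow>
     (\<forall>F\<in>V. T F \<in> W) \<and>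
     (\<forall>F\<in>V. \<forall>G\<in>V. T (\<lambda>x. F x + G x) = (\<lambda>y. T F y + T G y)) \<and>
     (\<forall>c. \<forall>F\<in>V. T (\<lambda>x. c * F x) = (\<lambda>y. c * T F y)) \<and>
     (\<exists>C. \<forall>F\<in>V. q (T F) \<le> C * p F)"

definition positive_operator ::
    "(real^'d) set \<Rightarrow> (real^'d \<Rightarrow> real) \<Rightarrow> nat
      \<Rightarrow> ((complex^'d \<Rightarrow> complex) \<Rightarrow> (complex^'d \<Rightarrow> complex)) \<Rightarrow> bool" where
  "positive_operator \<Omega> \<rho> n T \<longleftrightarrow>
     (\<forall>F\<in>hardy_sobolev \<Omega> \<rho> n. hs_inner \<Omega> \<rho> n (T F) F \<in> \<real>\<^sub>\<ge>\<^sub>0)"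

definition form_B ::
    "(complex^'d) measure \<Rightarrow> (complex^'d \<Rightarrow> complex) \<Rightarrow> (complex^'d \<Rightarrow> complex) \<Rightarrow> complex" where
  "form_B \<mu> F G = (LINT z|\<mu>. F z * cnj (G z))"

definition form_B_converges ::
    "(real^'d) set \<Rightarrow> (real^'d \<Rightarrow> real) \<Rightarrow> nat \<Rightarrow> (complex^'d) measure \<Rightarrow> bool" where
  "form_B_converges \<Omega> \<rho> n \<mu> \<longleftrightarrow>
     (\<forall>F\<in>hardy_sobolev \<Omega> \<rho> n. \<forall>G\<in>hardy_sobolev \<Omega> \<rho> n. integrable \<mu> (\<lambda>z. F z * cnj (G z)))"

definition form_B_bounded ::
    "(real^'d) set \<Rightarrow> (real^'d \<Rightarrow> real) \<Rightarrow> nat \<Rightarrow> (complex^'d) measure \<Rightarrow> bool" where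
  "form_B_bounded \<Omega> \<rho> n \<mu> \<longleftrightarrow>
     (\<exists>C. \<forall>F\<in>hardy_sobolev \<Omega> \<rho> n. \<forall>G\<in>hardy_sobolev \<Omega> \<rho> n.
        cmod (form_B \<mu> F G) \<le> C * hs_norm \<Omega> \<rho> n F * hs_norm \<Omega> \<rho> n G)"

end

theory Submission
  imports Defs
begin

text \<open>
  Conditions (i), (ii) and (iii) are three readings of one inequality: every
  \<open>F\<close> in the Hardy--Sobolev space \<open>H\<close> is square integrable for \<open>\<mu>\<close>, and its \<open>L\<^sup>2(\<mu>)\<close> norm is at
  most a constant times its norm in \<open>H\<close> (\<open>embeds\<close>). For (iii) one direction is the
  Cauchy--Schwarz inequality in \<open>L\<^sup>2(\<mu>)\<close>, the other is the diagonal \<open>G = F\<close> of the form. The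
  passage from (iii) to (iv) is the correspondence between bounded positive sesquilinear forms
  and bounded positive operators, which rests on the Riesz representation theorem in \<open>H\<close>; the way
  back is Cauchy--Schwarz in \<open>H\<close>.

  The substance is thus that \<open>H\<close> really is a Hilbert space of functions. Its inner product
  is computed from a chosen preimage under the Laplace transform, so it is additive and independent
  of choices only because the transform is injective up to null sets (\<open>laplace_injective\<close>), and a
  vector found by the Riesz theorem lies in \<open>H\<close> only because the transform of every admissible function is
  holomorphic (\<open>laplace_holomorphic\<close>). Both use that \<open>\<langle>y, \<xi>\<rangle>\<close> grows at least linearly on the dual cone
  for every \<open>y\<close> in the open cone, so that the Laplace kernel decays exponentially.

  Injectivity is a Stone--Weierstrass argument. If \<open>h\<close> is the difference of two functions with the
  same transform, then \<open>h\<close> is annihilated by all exponentials \<open>exp (- \<langle>y, \<xi>\<rangle>)\<close> with \<open>y\<close> in the cone.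
  These are closed under multiplication because the cone is closed under addition, and finitely
  many of them embed the dual cone in a cube. Polynomials in these
  finitely many exponentials, hence continuous functions of them, hence indicators of compact sets,
  integrate to zero against \<open>h\<close> times one of the exponentials.

  The Riesz theorem is proved for \<open>L\<^sup>2\<close> of an arbitrary measure
  by minimising \<open>\<parallel>f\<parallel>\<^sup>2 - 2 Re (\<phi> f)\<close>, and it is carried over to \<open>H\<close> by the isometry sending
  \<open>F\<close> to its preimage times the square root of the weight.
\<close>

section \<open>Square integrable functions\<close>

definition L2_inner :: "'a measure \<Rightarrow> ('a \<Rightarrow> complex) \<Rightarrow> ('a \<Rightarrow> complex) \<Rightarrow> complex" where
  "L2_inner M f g = (LINT x|M. f x * cnj (g x))"

lemma L2_space_measurable: "f \<in> L2_space M \<Longrightarrow> f \<in> borel_measurable M"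
  by (simp add: L2_space_def)

lemma L2_space_sq_integrable: "f \<in> L2_space M \<Longrightarrow> integrable M (\<lambda>x. (cmod (f x))\<^sup>2)"
  by (simp add: L2_space_def)

lemma L2_space_norm_mult_integrable:
  assumes "f \<in> L2_space M" "g \<in> L2_space M"
  shows "integrable M (\<lambda>x. cmod (f x) * cmod (g x))"
proof (rule Bochner_Integration.integrable_bound)
  show "integrable M (\<lambda>x. (cmod (f x))\<^sup>2 + (cmod (g x))\<^sup>2)"
    using assms by (auto dest: L2_space_sq_integrable)
  show "(\<lambda>x. cmod (f x) * cmod (g x)) \<in> borel_measurable M"
    using assms by (auto dest!: L2_space_measurable)
  have "a * b \<le> a\<^sup>2 + b\<^sup>2" for a b :: real
    using sum_squares_bound[of a b] zero_le_power2[of a] zero_le_power2[of b] by linarith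
  then show "AE x in M. norm (cmod (f x) * cmod (g x)) \<le> norm ((cmod (f x))\<^sup>2 + (cmod (g x))\<^sup>2)"
    by (auto simp: abs_mult)
qed

lemma L2_space_mult_cnj_integrable:
  assumes "f \<in> L2_space M" "g \<in> L2_space M"
  shows "integrable M (\<lambda>x. f x * cnj (g x))"
proof (rule Bochner_Integration.integrable_bound)
  show "integrable M (\<lambda>x. cmod (f x) * cmod (g x))"
    using assms by (rule L2_space_norm_mult_integrable)
  have [measurable]: "f \<in> borel_measurable M" "g \<in> borel_measurable M"
    using assms by (auto dest!: L2_space_measurable)
  have "(\<lambda>x. cnj (g x)) \<in> borel_measurable M"
    using borel_measurable_continuous_onI[of cnj] by (auto intro!: measurable_compose[of g M] continuous_intros)
  then show "(\<lambda>x. f x * cnj (g x)) \<in> borel_measurable M" by simp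
qed (auto simp: norm_mult)

lemma L2_space_add:
  assumes "f \<in> L2_space M" "g \<in> L2_space M"
  shows "(\<lambda>x. f x + g x) \<in> L2_space M"
proof -
  have m: "f \<in> borel_measurable M" "g \<in> borel_measurable M"
    using assms by (auto dest!: L2_space_measurable)
  have i: "integrable M (\<lambda>x. (cmod (f x))\<^sup>2 + (cmod (g x))\<^sup>2 + 2 * (cmod (f x) * cmod (g x)))"
    using assms by (intro Bochner_Integration.integrable_add integrable_mult_right
        L2_space_sq_integrable L2_space_norm_mult_integrable)
  have "integrable M (\<lambda>x. (cmod (f x + g x))\<^sup>2)"
  proof (rule Bochner_Integration.integrable_bound[OF i])
    have "(cmod (f x + g x))\<^sup>2 \<le> (cmod (f x))\<^sup>2 + (cmod (g x))\<^sup>2 + 2 * (cmod (f x) * cmod (g x))" for x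
      using power_mono[OF norm_triangle_ineq[of "f x" "g x"], of 2] by (simp add: power2_sum mult.assoc)
    then show "AE x in M. norm ((cmod (f x + g x))\<^sup>2)
        \<le> norm ((cmod (f x))\<^sup>2 + (cmod (g x))\<^sup>2 + 2 * (cmod (f x) * cmod (g x)))"
      by auto
  qed (use m in measurable)
  with m show ?thesis by (simp add: L2_space_def)
qed

lemma L2_space_scale:
  assumes "f \<in> L2_space M"
  shows "(\<lambda>x. c * f x) \<in> L2_space M"
  using assms by (auto simp: L2_space_def norm_mult power_mult_distrib)

lemma L2_space_diff:
  assumes "f \<in> L2_space M" "g \<in> L2_space M"
  shows "(\<lambda>x. f x - g x) \<in> L2_space M"
  using L2_space_add[OF assms(1) L2_space_scale[OF assms(2), of "-1"]] by simp

lemma L2_norm_nonneg: "0 \<le> L2_norm M f"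
  by (simp add: L2_norm_def)

lemma L2_norm_squared: "(L2_norm M f)\<^sup>2 = (LINT x|M. (cmod (f x))\<^sup>2)"
  by (simp add: L2_norm_def)

lemma L2_inner_self: "L2_inner M f f = complex_of_real ((L2_norm M f)\<^sup>2)"
  unfolding L2_inner_def L2_norm_squared
  by (simp add: complex_norm_square[symmetric] flip: integral_complex_of_real of_real_power)

lemma L2_inner_commute: "L2_inner M g f = cnj (L2_inner M f g)"
proof -
  have "(\<lambda>x. g x * cnj (f x)) = (\<lambda>x. cnj (f x * cnj (g x)))"
    by (simp add: mult.commute)
  then show ?thesis
    unfolding L2_inner_def using Bochner_Integration.integral_cnj[of M "\<lambda>x. f x * cnj (g x)"] by simp
qed

lemma L2_inner_add_left:
  assumes "f \<in> L2_space M" "g \<in> L2_space M" "h \<in> L2_space M"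
  shows "L2_inner M (\<lambda>x. f x + g x) h = L2_inner M f h + L2_inner M g h"
  using assms by (simp add: L2_inner_def ring_distribs L2_space_mult_cnj_integrable)

lemma L2_inner_diff_left:
  assumes "f \<in> L2_space M" "g \<in> L2_space M" "h \<in> L2_space M"
  shows "L2_inner M (\<lambda>x. f x - g x) h = L2_inner M f h - L2_inner M g h"
  using assms by (simp add: L2_inner_def ring_distribs L2_space_mult_cnj_integrable)

lemma L2_inner_scale_left: "L2_inner M (\<lambda>x. c * f x) h = c * L2_inner M f h"
  by (simp add: L2_inner_def mult.assoc)

text \<open>
  The quadratic polynomial in a real parameter behind both the Cauchy--Schwarz inequality and the
  variational argument for the Riesz theorem.
\<close>

lemma L2_norm_add_scaled_squared:
  assumes "f \<in> L2_space M" "g \<in> L2_space M"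
  shows "(L2_norm M (\<lambda>x. f x + complex_of_real t * g x))\<^sup>2
    = (L2_norm M f)\<^sup>2 + 2 * t * Re (L2_inner M f g) + t\<^sup>2 * (L2_norm M g)\<^sup>2"
proof -
  have e: "(cmod (f x + complex_of_real t * g x))\<^sup>2
      = (cmod (f x))\<^sup>2 + 2 * t * Re (f x * cnj (g x)) + t\<^sup>2 * (cmod (g x))\<^sup>2" for x
    unfolding cmod_power2 by (simp add: algebra_simps power2_eq_square)
  have i: "integrable M (\<lambda>x. Re (f x * cnj (g x)))"
    using L2_space_mult_cnj_integrable[OF assms] by (rule integrable_Re)
  show ?thesis
    unfolding L2_norm_squared L2_inner_def e integral_Re[OF L2_space_mult_cnj_integrable[OF assms], symmetric]
    using i assms[THEN L2_space_sq_integrable] by simp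
qed

lemma nonneg_quadratic_discriminant:
  fixes a b c :: real
  assumes "\<And>t. 0 \<le> a + 2 * t * b + t\<^sup>2 * c" "0 \<le> c"
  shows "b\<^sup>2 \<le> a * c"
proof (cases "c = 0")
  case True
  have "b = 0"
  proof (rule ccontr)
    assume "b \<noteq> 0"
    then show False using assms(1)[of "- (a + 1) / (2 * b)"] True by (simp add: field_simps)
  qed
  with True show ?thesis by simp
next
  case False
  with assms have "c > 0" by simp
  have "0 \<le> c * (a + 2 * (- b / c) * b + (- b / c)\<^sup>2 * c)"
    using assms(2,1) by (rule mult_nonneg_nonneg)
  also have "\<dots> = a * c - b\<^sup>2" using \<open>c > 0\<close> by (simp add: field_simps power2_eq_square)
  finally show ?thesis by simp
qed

lemma L2_Cauchy_Schwarz_Re: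
  assumes "f \<in> L2_space M" "g \<in> L2_space M"
  shows "\<bar>Re (L2_inner M f g)\<bar> \<le> L2_norm M f * L2_norm M g"
proof -
  have "(Re (L2_inner M f g))\<^sup>2 \<le> (L2_norm M f)\<^sup>2 * (L2_norm M g)\<^sup>2"
    by (rule nonneg_quadratic_discriminant)
      (simp_all flip: L2_norm_add_scaled_squared[OF assms])
  then show ?thesis
    by (metis abs_le_square_iff abs_mult abs_of_nonneg L2_norm_nonneg power_mult_distrib)
qed

text \<open>
  The modulus of the integral is at most the integral of \<open>cmod f * cmod g\<close>, which is the inner
  product of two real functions, so the inequality for real parts suffices.
\<close>

lemma L2_Cauchy_Schwarz:
  assumes "f \<in> L2_space M" "g \<in> L2_space M"
  shows "cmod (L2_inner M f g) \<le> L2_norm M f * L2_norm M g"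
proof -
  let ?a = "\<lambda>x. complex_of_real (cmod (f x))" and ?b = "\<lambda>x. complex_of_real (cmod (g x))"
  have ab: "?a \<in> L2_space M" "?b \<in> L2_space M"
    using assms by (auto simp: L2_space_def)
  have "cmod (L2_inner M f g) \<le> (LINT x|M. cmod (f x) * cmod (g x))"
    unfolding L2_inner_def using integral_norm_bound[of M "\<lambda>x. f x * cnj (g x)"] by (simp add: norm_mult)
  also have "\<dots> = Re (L2_inner M ?a ?b)"
    unfolding L2_inner_def by (simp flip: of_real_mult)
  also have "\<dots> \<le> L2_norm M ?a * L2_norm M ?b"
    using L2_Cauchy_Schwarz_Re[OF ab] by simp
  also have "\<dots> = L2_norm M f * L2_norm M g" by (simp add: L2_norm_def)
  finally show ?thesis .
qed

lemma L2_inner_cong_AE: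
  assumes "f \<in> borel_measurable M" "f' \<in> borel_measurable M" "g \<in> borel_measurable M" "g' \<in> borel_measurable M"
    and "AE x in M. f x = f' x" "AE x in M. g x = g' x"
  shows "L2_inner M f g = L2_inner M f' g'"
  unfolding L2_inner_def
proof (rule integral_cong_AE)
  have cnj: "(\<lambda>x. cnj (h x)) \<in> borel_measurable M" if "h \<in> borel_measurable M" for h
    using that borel_measurable_continuous_onI[OF continuous_on_cnj[OF continuous_on_id]]
    by (rule measurable_compose)
  show "(\<lambda>x. f x * cnj (g x)) \<in> borel_measurable M" "(\<lambda>x. f' x * cnj (g' x)) \<in> borel_measurable M"
    by (intro borel_measurable_times cnj assms)+
  show "AE x in M. f x * cnj (g x) = f' x * cnj (g' x)"
    using assms(5,6) by eventually_elim simp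
qed

lemma L2_norm_eq_0_AE:
  assumes "f \<in> L2_space M" "L2_norm M f = 0"
  shows "AE x in M. f x = 0"
proof -
  have "(LINT x|M. (cmod (f x))\<^sup>2) = 0" using assms(2) L2_norm_squared[of M f] by simp
  then have "AE x in M. (cmod (f x))\<^sup>2 = 0"
    using integral_nonneg_eq_0_iff_AE[OF L2_space_sq_integrable[OF assms(1)]] by simp
  then show ?thesis by eventually_elim simp
qed

lemma L2_norm_via_nn_integral:
  assumes "f \<in> borel_measurable M" "(\<integral>\<^sup>+x. ennreal ((cmod (f x))\<^sup>2) \<partial>M) \<le> ennreal c" "0 \<le> c"
  shows "f \<in> L2_space M" "(L2_norm M f)\<^sup>2 \<le> c"
proof -
  have i: "integrable M (\<lambda>x. (cmod (f x))\<^sup>2)"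
    using assms by (intro integrableI_bounded) (auto intro: le_less_trans)
  then show "f \<in> L2_space M" using assms(1) by (simp add: L2_space_def)
  have "ennreal ((L2_norm M f)\<^sup>2) \<le> ennreal c"
    unfolding L2_norm_squared using i assms(2) by (simp add: nn_integral_eq_integral)
  then show "(L2_norm M f)\<^sup>2 \<le> c" using assms(3) by simp
qed

lemma nn_integral_L2_norm:
  assumes "f \<in> L2_space M"
  shows "(\<integral>\<^sup>+x. ennreal ((cmod (f x))\<^sup>2) \<partial>M) = ennreal ((L2_norm M f)\<^sup>2)"
  using assms by (simp add: L2_norm_squared nn_integral_eq_integral L2_space_def)

text \<open>
  The Riesz--Fischer theorem for rapidly Cauchy sequences, which is the form that a minimising
  sequence supplies. With \<open>a\<^sub>k\<close> the squared modulus of the \<open>k\<close>-th increment, the series of the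
  \<open>2\<^sup>k a\<^sub>k\<close> has finite integral. At almost every point its terms are therefore bounded, so the
  increments are dominated by a geometric series and the sequence converges; Fatou's lemma turns the
  pointwise limit into a limit in norm.
\<close>

lemma L2_complete_fast:
  assumes u: "\<And>n. u n \<in> L2_space M"
    and fast: "\<And>n m. n \<le> m \<Longrightarrow> (L2_norm M (\<lambda>x. u m x - u n x))\<^sup>2 \<le> (1/4)^n"
  obtains g where "g \<in> L2_space M" "\<And>n. (L2_norm M (\<lambda>x. u n x - g x))\<^sup>2 \<le> (1/4)^n"
proof -
  have [measurable]: "u n \<in> borel_measurable M" for n
    using u by (rule L2_space_measurable)
  define a where "a n x = (cmod (u (Suc n) x - u n x))\<^sup>2" for n x
  have [measurable]: "a n \<in> borel_measurable M" for n unfolding a_def by measurable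
  have "(\<integral>\<^sup>+x. (\<Sum>n. ennreal (2^n * a n x)) \<partial>M) = (\<Sum>n. \<integral>\<^sup>+x. ennreal (2^n * a n x) \<partial>M)"
    by (rule nn_integral_suminf) measurable
  also have "\<dots> \<le> (\<Sum>n. ennreal ((1/2)^n))"
  proof (intro suminf_le summableI)
    fix n
    have "(\<integral>\<^sup>+x. ennreal (2^n * a n x) \<partial>M) = ennreal (2^n) * (\<integral>\<^sup>+x. ennreal (a n x) \<partial>M)"
      by (simp add: ennreal_mult a_def nn_integral_cmult)
    also have "\<dots> = ennreal (2^n) * ennreal ((L2_norm M (\<lambda>x. u (Suc n) x - u n x))\<^sup>2)"
      unfolding a_def by (subst nn_integral_L2_norm) (auto intro: L2_space_diff u)
    also have "\<dots> = ennreal (2^n * (L2_norm M (\<lambda>x. u (Suc n) x - u n x))\<^sup>2)"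
      by (simp add: ennreal_mult)
    also have "\<dots> \<le> ennreal (2^n * (1/4)^n)"
      using fast[of n "Suc n"] by (intro ennreal_leI mult_left_mono) auto
    also have "2^n * (1/4)^n = ((1/2)^n :: real)"
      by (simp flip: power_mult_distrib)
    finally show "(\<integral>\<^sup>+x. ennreal (2^n * a n x) \<partial>M) \<le> ennreal ((1/2)^n)" .
  qed
  also have "\<dots> < \<infinity>"
    by (subst suminf_ennreal2) (auto intro: summable_geometric)
  finally have "AE x in M. (\<Sum>n. ennreal (2^n * a n x)) \<noteq> \<infinity>"
    by (intro nn_integral_PInf_AE) auto
  then have AE_conv: "AE x in M. convergent (\<lambda>n. u n x)"
  proof eventually_elim
    case (elim x)
    then have s: "summable (\<lambda>n. 2^n * a n x)"
      by (intro summable_suminf_not_top) (auto simp: a_def)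
    then obtain K where K: "\<And>n. 2^n * a n x \<le> K"
      using summable_imp_Bseq[OF s] by (auto simp: Bseq_def abs_le_iff)
    have K0: "0 \<le> K" using K[of 0] by (simp add: a_def) (meson order_trans zero_le_power2)
    have "summable (\<lambda>n. u (Suc n) x - u n x)"
    proof (rule summable_comparison_test')
      show "summable (\<lambda>n. sqrt K * (sqrt (1/2))^n)"
        by (intro summable_mult summable_geometric) (auto simp: real_sqrt_lt_1_iff)
      fix n :: nat
      have "a n x \<le> K * (1/2)^n"
        using K[of n] by (simp add: field_simps)
      then have "sqrt (a n x) \<le> sqrt (K * (1/2)^n)" by simp
      then show "norm (u (Suc n) x - u n x) \<le> sqrt K * (sqrt (1/2))^n"
        by (simp add: a_def real_sqrt_mult real_sqrt_power)
    qed
    then show "convergent (\<lambda>n. u n x)"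
      by (simp add: summable_iff_convergent sum_lessThan_telescope[of "\<lambda>n. u n x"]
          convergent_diff_const_right_iff)
  qed
  define g where "g x = lim (\<lambda>n. u n x)" for x
  have [measurable]: "g \<in> borel_measurable M"
    unfolding g_def by (rule borel_measurable_lim_metric) measurable
  have bound: "(\<integral>\<^sup>+x. ennreal ((cmod (u n x - g x))\<^sup>2) \<partial>M) \<le> ennreal ((1/4)^n)" for n
  proof -
    have "(\<integral>\<^sup>+x. ennreal ((cmod (u n x - g x))\<^sup>2) \<partial>M)
        = (\<integral>\<^sup>+x. liminf (\<lambda>m. ennreal ((cmod (u m x - u n x))\<^sup>2)) \<partial>M)"
    proof (rule nn_integral_cong_AE)
      show "AE x in M. ennreal ((cmod (u n x - g x))\<^sup>2) = liminf (\<lambda>m. ennreal ((cmod (u m x - u n x))\<^sup>2))"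
        using AE_conv
      proof eventually_elim
        case (elim x)
        then have "(\<lambda>m. u m x) \<longlonglongrightarrow> g x"
          by (simp add: g_def convergent_LIMSEQ_iff)
        then have "(\<lambda>m. ennreal ((cmod (u m x - u n x))\<^sup>2)) \<longlonglongrightarrow> ennreal ((cmod (g x - u n x))\<^sup>2)"
          by (intro tendsto_intros)
        from lim_imp_Liminf[OF _ this] show ?case
          by (simp add: norm_minus_commute)
      qed
    qed
    also have "\<dots> \<le> liminf (\<lambda>m. \<integral>\<^sup>+x. ennreal ((cmod (u m x - u n x))\<^sup>2) \<partial>M)"
      by (rule nn_integral_liminf) measurable
    also have "\<dots> \<le> liminf (\<lambda>m. ennreal ((1/4)^n))"
    proof (rule Liminf_mono)
      show "\<forall>\<^sub>F m in sequentially. (\<integral>\<^sup>+x. ennreal ((cmod (u m x - u n x))\<^sup>2) \<partial>M) \<le> ennreal ((1/4)^n)"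
        using eventually_ge_at_top[of n]
      proof eventually_elim
        case (elim m)
        have "(\<integral>\<^sup>+x. ennreal ((cmod (u m x - u n x))\<^sup>2) \<partial>M) = ennreal ((L2_norm M (\<lambda>x. u m x - u n x))\<^sup>2)"
          by (rule nn_integral_L2_norm) (intro L2_space_diff u)
        then show ?case using fast[OF elim] by (simp add: ennreal_leI)
      qed
    qed
    also have "\<dots> = ennreal ((1/4)^n)" by (simp add: Liminf_const)
    finally show ?thesis .
  qed
  have *: "(\<lambda>x. u n x - g x) \<in> L2_space M" "(L2_norm M (\<lambda>x. u n x - g x))\<^sup>2 \<le> (1/4)^n" for n
    using L2_norm_via_nn_integral[OF _ bound[of n]] by auto
  have "g \<in> L2_space M"
    using L2_space_diff[OF u[of 0] *(1)[of 0]] by simp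
  with *(2) show thesis using that by blast
qed

text \<open>
  By the parallelogram identity a minimising sequence of \<open>J f = \<parallel>f\<parallel>\<^sup>2 - 2 Re (\<phi> f)\<close> is Cauchy, and the
  first-order condition at its limit \<open>g\<close> says that \<open>\<phi>\<close> and the inner product with \<open>g\<close> have equal real parts.
  Complex linearity extends this to the imaginary parts.
\<close>

theorem L2_Riesz_representation:
  assumes add: "\<And>f g. f \<in> L2_space M \<Longrightarrow> g \<in> L2_space M \<Longrightarrow> \<phi> (\<lambda>x. f x + g x) = \<phi> f + \<phi> g"
    and scale: "\<And>c f. f \<in> L2_space M \<Longrightarrow> \<phi> (\<lambda>x. c * f x) = c * \<phi> f"
    and bounded: "\<And>f. f \<in> L2_space M \<Longrightarrow> cmod (\<phi> f) \<le> C * L2_norm M f"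
  obtains g where "g \<in> L2_space M" "\<And>f. f \<in> L2_space M \<Longrightarrow> \<phi> f = L2_inner M f g"
proof -
  define J where "J f = (L2_norm M f)\<^sup>2 - 2 * Re (\<phi> f)" for f
  define m where "m = Inf (J ` L2_space M)"
  have zero: "(\<lambda>x. 0) \<in> L2_space M" by (simp add: L2_space_def)
  have "- C\<^sup>2 \<le> J f" if "f \<in> L2_space M" for f
  proof -
    have "Re (\<phi> f) \<le> C * L2_norm M f"
      using bounded[OF that] complex_Re_le_cmod[of "\<phi> f"] by linarith
    then show ?thesis
      unfolding J_def using zero_le_power2[of "L2_norm M f - C"] by (simp add: power2_diff algebra_simps)
  qed
  then have bdd: "bdd_below (J ` L2_space M)" by (auto simp: bdd_below_def)
  have m_le: "m \<le> J f" if "f \<in> L2_space M" for f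
    unfolding m_def using bdd that by (auto intro: cInf_lower)
  \<comment> \<open>The parallelogram identity bounds a squared distance by four times the larger gap, so this gap
    yields the rate \<open>(1/4)\<^sup>n\<close> required by \<open>L2_complete_fast\<close>.\<close>
  have "\<exists>f\<in>L2_space M. J f < m + (1/4)^n / 4" for n
  proof -
    have "\<exists>y\<in>J ` L2_space M. y < m + (1/4)^n / 4"
      unfolding m_def by (rule cInf_lessD) (use zero in auto)
    then show ?thesis by auto
  qed
  then obtain u where u: "\<And>n. u n \<in> L2_space M" and Ju: "\<And>n. J (u n) < m + (1/4)^n / 4"
    by metis
  have J_add: "J (\<lambda>x. f x + complex_of_real t * h x)
      = J f + 2 * t * (Re (L2_inner M f h) - Re (\<phi> h)) + t\<^sup>2 * (L2_norm M h)\<^sup>2"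
    if "f \<in> L2_space M" "h \<in> L2_space M" for f h t
    unfolding J_def L2_norm_add_scaled_squared[OF that] using that
    by (simp add: add scale L2_space_scale algebra_simps)
  have close: "(L2_norm M (\<lambda>x. u k x - u n x))\<^sup>2 \<le> (1/4)^n" if "n \<le> k" for n k
  proof -
    \<comment> \<open>Compare \<open>J\<close> at the two ends and at the midpoint of the segment from \<open>u n\<close> to \<open>u k\<close>;
      it is at least \<open>m\<close> at the midpoint and nearly \<open>m\<close> at the ends.\<close>
    let ?h = "\<lambda>x. u k x - u n x"
    have h: "?h \<in> L2_space M" by (intro L2_space_diff u)
    have "J (u k) = J (\<lambda>x. u n x + complex_of_real 1 * ?h x)" by simp
    also note J_add[OF u h]
    finally have 1: "J (u k) = J (u n) + 2 * (Re (L2_inner M (u n) ?h) - Re (\<phi> ?h)) + (L2_norm M ?h)\<^sup>2"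
      by simp
    have "m \<le> J (\<lambda>x. u n x + complex_of_real (1/2) * ?h x)"
      by (intro m_le L2_space_add u L2_space_scale h)
    also note J_add[OF u h]
    finally have 2: "m \<le> J (u n) + (Re (L2_inner M (u n) ?h) - Re (\<phi> ?h)) + (L2_norm M ?h)\<^sup>2 / 4"
      by (simp add: power2_eq_square)
    have "(1/4 :: real)^k \<le> (1/4)^n" using that by (intro power_decreasing) auto
    with 1 2 Ju[of n] Ju[of k] show ?thesis by argo
  qed
  obtain g where g: "g \<in> L2_space M" and ug: "\<And>n. (L2_norm M (\<lambda>x. u n x - g x))\<^sup>2 \<le> (1/4)^n"
    using L2_complete_fast[OF u close] by blast
  have real_part: "Re (\<phi> h) = Re (L2_inner M h g)" if h: "h \<in> L2_space M" for h
  proof -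
    have lim: "(\<lambda>n. Re (L2_inner M (u n) h)) \<longlonglongrightarrow> Re (L2_inner M g h)"
    proof -
      have "(\<lambda>n. Re (L2_inner M (u n) h) - Re (L2_inner M g h)) \<longlonglongrightarrow> 0"
      proof (rule Lim_null_comparison)
        show "\<forall>\<^sub>F n in sequentially. norm (Re (L2_inner M (u n) h) - Re (L2_inner M g h)) \<le> (1/2)^n * L2_norm M h"
        proof (rule always_eventually, rule allI)
          fix n
          have "L2_norm M (\<lambda>x. u n x - g x) \<le> (1/2)^n"
            by (rule power2_le_imp_le) (use ug[of n] in \<open>simp_all add: power2_eq_square flip: power_mult_distrib\<close>)
          then have "L2_norm M (\<lambda>x. u n x - g x) * L2_norm M h \<le> (1/2)^n * L2_norm M h"
            by (rule mult_right_mono) (rule L2_norm_nonneg)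
          with L2_Cauchy_Schwarz_Re[OF L2_space_diff[OF u[of n] g] h]
          show "norm (Re (L2_inner M (u n) h) - Re (L2_inner M g h)) \<le> (1/2)^n * L2_norm M h"
            by (simp add: L2_inner_diff_left u g h)
        qed
        show "(\<lambda>n. (1/2)^n * L2_norm M h) \<longlonglongrightarrow> 0"
          by (intro tendsto_mult_left_zero LIMSEQ_power_zero) auto
      qed
      then show ?thesis by (simp add: LIM_zero_iff)
    qed
    \<comment> \<open>Near-minimality of \<open>u n\<close> makes the change of \<open>J\<close> along the line through \<open>u n\<close> in direction
      \<open>h\<close> almost nonnegative. Passing to the limit here avoids showing that \<open>g\<close> itself is a minimiser.\<close>
    have nonneg: "0 \<le> 0 + 2 * t * (Re (L2_inner M g h) - Re (\<phi> h)) + t\<^sup>2 * (L2_norm M h)\<^sup>2" for t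
    proof (rule LIMSEQ_le)
      show "(\<lambda>n. - ((1/4)^n / 4)) \<longlonglongrightarrow> (0::real)"
        by (rule tendsto_eq_intros LIMSEQ_power_zero | simp)+
      show "(\<lambda>n. 0 + 2 * t * (Re (L2_inner M (u n) h) - Re (\<phi> h)) + t\<^sup>2 * (L2_norm M h)\<^sup>2)
        \<longlonglongrightarrow> 0 + 2 * t * (Re (L2_inner M g h) - Re (\<phi> h)) + t\<^sup>2 * (L2_norm M h)\<^sup>2"
        by (intro tendsto_intros lim)
      have "- ((1/4)^n / 4) \<le> 0 + 2 * t * (Re (L2_inner M (u n) h) - Re (\<phi> h)) + t\<^sup>2 * (L2_norm M h)\<^sup>2" for n
        using m_le[OF L2_space_add[OF u[of n] L2_space_scale[OF h, of "complex_of_real t"]]]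
          Ju[of n] J_add[OF u[of n] h, of t] by linarith
      then show "\<exists>N. \<forall>n\<ge>N. - ((1/4)^n / 4) \<le> 0 + 2 * t * (Re (L2_inner M (u n) h) - Re (\<phi> h)) + t\<^sup>2 * (L2_norm M h)\<^sup>2"
        by blast
    qed
    \<comment> \<open>A nonnegative quadratic polynomial without constant term has no linear term.\<close>
    have "(Re (L2_inner M g h) - Re (\<phi> h))\<^sup>2 \<le> 0 * (L2_norm M h)\<^sup>2"
      by (rule nonneg_quadratic_discriminant) (use nonneg in auto)
    then show ?thesis by (simp add: L2_inner_commute[of M h g])
  qed
  have "\<phi> f = L2_inner M f g" if f: "f \<in> L2_space M" for f
  proof (rule complex_eqI)
    show "Re (\<phi> f) = Re (L2_inner M f g)" using f by (rule real_part)
    show "Im (\<phi> f) = Im (L2_inner M f g)"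
      using real_part[OF L2_space_scale[OF f, of \<i>]] f by (simp add: scale L2_inner_scale_left)
  qed
  with g show thesis using that by blast
qed

section \<open>Two facts on Lebesgue measure\<close>

text \<open>
  Since the sum of the absolute coordinates is at most the dimension times the norm, the function
  is dominated by a product of one-dimensional exponentials.
\<close>

lemma integrable_exp_norm:
  fixes a :: real
  assumes "0 < a"
  shows "integrable lborel (\<lambda>x::'a::euclidean_space. exp (- a * norm x))"
proof -
  define c where "c = a / real DIM('a)"
  have c: "0 < c" using assms by (simp add: c_def)
  have half: "(\<integral>\<^sup>+x. ennreal (exp (- c * x)) * indicator {0..} x \<partial>lborel) = ennreal (1 / c)"
  proof -
    have "(\<integral>\<^sup>+x. ennreal (exp (- c * x)) * indicator {0..} x \<partial>lborel) = ennreal (0 - (- exp (- c * 0) / c))"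
    proof (rule nn_integral_FTC_atLeast)
      show "((\<lambda>x. - exp (- c * x) / c) has_real_derivative exp (- c * x)) (at x)" for x
        using c by (auto intro!: derivative_eq_intros)
      have "((\<lambda>x. exp (- c * x)) \<longlongrightarrow> 0) at_top"
        by (rule filterlim_compose[OF exp_at_bot])
          (use c in \<open>intro filterlim_tendsto_neg_mult_at_bot[OF tendsto_const] filterlim_ident, simp\<close>)
      from tendsto_divide[OF tendsto_minus[OF this] tendsto_const[of c]]
      show "((\<lambda>x. - exp (- c * x) / c) \<longlongrightarrow> 0) at_top"
        using c by simp
    qed auto
    then show ?thesis by simp
  qed
  have one_dim: "(\<integral>\<^sup>+x. ennreal (exp (- c * \<bar>x\<bar>)) \<partial>lborel) < \<infinity>"
  proof -
    have "(\<integral>\<^sup>+x. ennreal (exp (- c * \<bar>x\<bar>)) \<partial>lborel)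
      \<le> (\<integral>\<^sup>+x. ennreal (exp (- c * x)) * indicator {0..} x
             + ennreal (exp (- c * (0 + (-1) * x))) * indicator {0..} (0 + (-1) * x) \<partial>lborel)"
      by (rule nn_integral_mono) (auto simp: indicator_def)
    also have "\<dots> = (\<integral>\<^sup>+x. ennreal (exp (- c * x)) * indicator {0..} x \<partial>lborel)
        + (\<integral>\<^sup>+x. ennreal (exp (- c * (0 + (-1) * x))) * indicator {0..} (0 + (-1) * x) \<partial>lborel)"
      by (rule nn_integral_add) measurable
    also have "(\<integral>\<^sup>+x. ennreal (exp (- c * (0 + (-1) * x))) * indicator {0..} (0 + (-1) * x) \<partial>lborel)
        = (\<integral>\<^sup>+x. ennreal (exp (- c * x)) * indicator {0..} x \<partial>lborel)"
      by (subst (2) nn_integral_real_affine[where c = "-1" and t = 0]) simp_all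
    finally show ?thesis unfolding half by (simp add: le_less_trans)
  qed
  show ?thesis
  proof (rule integrableI_bounded)
    have "exp (- a * norm x) \<le> (\<Prod>b\<in>Basis. exp (- c * \<bar>x \<bullet> b\<bar>))" for x :: 'a
    proof -
      have "(\<Sum>b\<in>Basis. \<bar>x \<bullet> b\<bar>) \<le> (\<Sum>b\<in>(Basis::'a set). norm x)"
        by (rule sum_mono) (rule Basis_le_norm)
      then have "c * (\<Sum>b\<in>Basis. \<bar>x \<bullet> b\<bar>) \<le> a * norm x"
        using c mult_left_mono[of "\<Sum>b\<in>Basis. \<bar>x \<bullet> b\<bar>" "real DIM('a) * norm x" c] by (simp add: c_def)
      then show ?thesis
        by (simp add: sum_negf sum_distrib_left flip: exp_sum)
    qed
    then have "(\<integral>\<^sup>+x. ennreal (norm (exp (- a * norm x))) \<partial>(lborel :: 'a measure))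
        \<le> (\<integral>\<^sup>+x. (\<Prod>b\<in>Basis. ennreal (exp (- c * \<bar>x \<bullet> b\<bar>))) \<partial>(lborel :: 'a measure))"
      by (intro nn_integral_mono) (simp add: prod_ennreal ennreal_leI)
    also have "\<dots> = (\<Prod>b\<in>(Basis::'a set). (\<integral>\<^sup>+x. ennreal (exp (- c * \<bar>x\<bar>)) \<partial>lborel))"
      by (rule nn_integral_lborel_prod) auto
    also have "\<dots> < \<infinity>"
      using one_dim by (simp add: power_eq_top_ennreal less_top[symmetric])
    finally show "(\<integral>\<^sup>+x. ennreal (norm (exp (- a * norm x))) \<partial>(lborel :: 'a measure)) < \<infinity>" .
  qed simp
qed

text \<open>
  Up to a null set every Lebesgue measurable set is an increasing union of compact sets, so
  the integrals over all measurable sets vanish.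
\<close>

lemma AE_zero_if_compact_integrals_zero:
  fixes g :: "'a::euclidean_space \<Rightarrow> complex"
  assumes D: "D \<in> sets lebesgue" and g: "integrable (lebesgue_on D) g"
    and zero: "\<And>K. compact K \<Longrightarrow> K \<subseteq> D \<Longrightarrow> (LINT x:K|lebesgue_on D. g x) = 0"
  shows "AE x in lebesgue_on D. g x = 0"
proof -
  have "(LINT x:A|lebesgue_on D. g x) = 0" if "A \<in> sets (lebesgue_on D)" for A
  proof -
    have A: "A \<in> sets lebesgue" "A \<subseteq> D"
      using that D by (auto simp: sets_restrict_space)
    then obtain C N where C: "fsigma C" and N: "N \<in> null_sets lebesgue" and CN: "C \<union> N = A"
      using lebesgue_set_almost_fsigma by metis
    obtain F :: "nat \<Rightarrow> 'a set" where F: "range F \<subseteq> Collect compact" "C = \<Union>(range F)"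
      using fsigma_Union_compact[THEN iffD1, OF C] by metis
    define G where "G n = (\<Union>i\<le>n. F i)" for n
    have G: "compact (G n)" "G n \<subseteq> D" for n
      using F A CN by (auto simp: G_def intro!: compact_UN)
    have UG: "(\<Union>n. G n) = C" using F by (auto simp: G_def)
    have Gm: "G n \<in> sets (lebesgue_on D)" for n
      using G[of n] D lmeasurable_compact[of "G n"] by (auto simp: sets_restrict_space_iff fmeasurableD)
    have "(\<lambda>n. LINT x:G n|lebesgue_on D. g x) \<longlonglongrightarrow> (LINT x:(\<Union>n. G n)|lebesgue_on D. g x)"
    proof (rule set_integral_cont_up[OF Gm])
      show "incseq G"
        unfolding G_def incseq_def by (intro allI impI UN_mono) auto
      show "set_integrable (lebesgue_on D) (\<Union>n. G n) g"
        unfolding set_integrable_def using Gm g by (intro integrable_mult_indicator) auto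
    qed
    then have "(LINT x:C|lebesgue_on D. g x) = 0"
      unfolding UG zero[OF G] by (simp add: LIMSEQ_const_iff)
    moreover have "(LINT x:A|lebesgue_on D. g x) = (LINT x:C|lebesgue_on D. g x)"
    proof -
      have "AE x in lebesgue. x \<notin> N" using N by (rule AE_not_in)
      then have "AE x in lebesgue_on D. x \<notin> N"
        using D by (subst AE_restrict_space_iff) auto
      moreover have "C \<in> sets (lebesgue_on D)" using Gm UG by auto
      ultimately show ?thesis
        unfolding set_lebesgue_integral_def using that g CN
        by (intro integral_cong_AE borel_measurable_scaleR borel_measurable_indicator borel_measurable_integrable)
          (auto simp: indicator_def)
    qed
    ultimately show "(LINT x:A|lebesgue_on D. g x) = 0" by simp
  qed
  then have "(LINT x:A|lebesgue_on D. Re (g x)) = 0" "(LINT x:A|lebesgue_on D. Im (g x)) = 0"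
    if "A \<in> sets (lebesgue_on D)" for A
    using that integral_Re[OF integrable_mult_indicator[OF that g]]
      integral_Im[OF integrable_mult_indicator[OF that g]]
    by (simp_all add: set_lebesgue_integral_def)
  then have "AE x in lebesgue_on D. Re (g x) = 0" "AE x in lebesgue_on D. Im (g x) = 0"
    using g by (auto intro!: density_unique_real simp: set_lebesgue_integral_def)
  then show ?thesis by eventually_elim (simp add: complex_eq_iff)
qed

section \<open>The Laplace kernel\<close>

lemma norm_bilin_le: "cmod (bilin z \<xi>) \<le> norm z * norm \<xi>"
proof -
  have "cmod (bilin z \<xi>) \<le> (\<Sum>j\<in>UNIV. cmod (z $ j) * norm (\<xi> $ j))"
    unfolding bilin_def by (rule order_trans[OF norm_sum]) (simp add: norm_mult)
  also have "\<dots> \<le> norm z * norm \<xi>"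
    unfolding norm_vec_def using L2_set_mult_ineq[of "\<lambda>j. cmod (z $ j)" "\<lambda>j. norm (\<xi> $ j)" UNIV] by simp
  finally show ?thesis .
qed

lemma bilin_add_left: "bilin (z + w) \<xi> = bilin z \<xi> + bilin w \<xi>"
  by (simp add: bilin_def ring_distribs sum.distrib)

lemma bilin_scale_left: "bilin (c *s z) \<xi> = c * bilin z \<xi>"
  by (simp add: bilin_def sum_distrib_left mult.assoc)

lemma continuous_on_bilin [continuous_intros]: "continuous_on S (bilin z)"
  unfolding bilin_def by (intro continuous_intros)

definition im_part :: "complex^'d \<Rightarrow> real^'d" where
  "im_part z = (\<chi> j. Im (z $ j))"

lemma Im_bilin: "Im (bilin z \<xi>) = im_part z \<bullet> \<xi>"
  by (simp add: bilin_def im_part_def inner_vec_def)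

lemma norm_exp_bilin: "cmod (exp (\<i> * bilin z \<xi>)) = exp (- (im_part z \<bullet> \<xi>))"
  by (simp add: Im_bilin)

lemma exp_remainder_bound: "cmod (exp w - 1 - w) \<le> (cmod w)\<^sup>2 * exp (cmod w)"
proof -
  have "cmod (exp w - 1 - w) \<le> exp \<bar>Re w\<bar> * (cmod w)\<^sup>2"
    using Taylor_exp[of w 1] by (simp add: power2_eq_square diff_diff_add)
  also have "\<dots> \<le> exp (cmod w) * (cmod w)\<^sup>2"
    by (intro mult_right_mono) (auto intro: abs_Re_le_cmod)
  finally show ?thesis by (simp add: mult.commute)
qed

section \<open>Open convex cones and exponential decay on the dual cone\<close>

locale open_convex_cone =
  fixes \<Omega> :: "(real^'d) set"
  assumes nonempty: "\<Omega> \<noteq> {}" and open_cone: "open \<Omega>" and convex_cone: "convex \<Omega>"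
    and cone: "x \<in> \<Omega> \<Longrightarrow> 0 < t \<Longrightarrow> t *\<^sub>R x \<in> \<Omega>"
begin

abbreviation dual_measure :: "(real^'d) measure" where
  "dual_measure \<equiv> lebesgue_on (dual_cone \<Omega>)"

lemma closed_dual_cone: "closed (dual_cone \<Omega>)"
proof -
  have "dual_cone \<Omega> = (\<Inter>x\<in>\<Omega>. {\<xi>. x \<bullet> \<xi> \<ge> 0})" by (auto simp: dual_cone_def)
  then show ?thesis by (simp add: closed_INT closed_halfspace_ge)
qed

lemma dual_cone_sets: "dual_cone \<Omega> \<in> sets lebesgue"
  using closed_dual_cone by auto

lemma continuous_measurable_dual:
  fixes f :: "real^'d \<Rightarrow> 'b::euclidean_space"
  shows "continuous_on (dual_cone \<Omega>) f \<Longrightarrow> f \<in> borel_measurable dual_measure"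
  by (rule continuous_imp_measurable_on_sets_lebesgue[OF _ dual_cone_sets])

lemma cone_add: "x \<in> \<Omega> \<Longrightarrow> y \<in> \<Omega> \<Longrightarrow> x + y \<in> \<Omega>"
  using convexD[OF convex_cone, of x y "1/2" "1/2"] cone[of "(1/2) *\<^sub>R x + (1/2) *\<^sub>R y" 2]
  by (simp add: scaleR_right_distrib)

text \<open>
  A small ball around \<open>y\<close> lies in the cone, so \<open>y\<close> can be moved a distance \<open>\<epsilon>\<close> in the direction
  opposite to \<open>\<xi>\<close> and still pair nonnegatively with \<open>\<xi>\<close>.
\<close>

lemma dual_cone_coercive:
  assumes "y \<in> \<Omega>"
  obtains \<epsilon> where "0 < \<epsilon>" "\<And>\<xi>. \<xi> \<in> dual_cone \<Omega> \<Longrightarrow> \<epsilon> * norm \<xi> \<le> y \<bullet> \<xi>"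
proof -
  obtain \<epsilon> where \<epsilon>: "0 < \<epsilon>" "cball y \<epsilon> \<subseteq> \<Omega>"
    using open_cone assms open_contains_cball by blast
  have "\<epsilon> * norm \<xi> \<le> y \<bullet> \<xi>" if "\<xi> \<in> dual_cone \<Omega>" for \<xi>
  proof (cases "\<xi> = 0")
    case False
    have "y - (\<epsilon> / norm \<xi>) *\<^sub>R \<xi> \<in> \<Omega>"
      using \<epsilon> False by (intro subsetD[OF \<epsilon>(2)]) (simp add: dist_norm)
    then have "0 \<le> (y - (\<epsilon> / norm \<xi>) *\<^sub>R \<xi>) \<bullet> \<xi>"
      using that by (simp add: dual_cone_def)
    then show ?thesis
      using False by (simp add: inner_diff_left power2_eq_square flip: power2_norm_eq_inner)
  qed simp
  with \<epsilon>(1) show thesis using that by blast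
qed

lemma exp_decay_integrable:
  assumes "0 < a"
  shows "integrable dual_measure (\<lambda>\<xi>. exp (- a * norm \<xi>))"
proof -
  have i: "integrable lebesgue (\<lambda>\<xi>::real^'d. exp (- a * norm \<xi>))"
    using integrable_exp_norm[OF assms] by (subst integrable_completion) auto
  show ?thesis
    using integrable_mult_indicator[OF dual_cone_sets i] dual_cone_sets
    by (subst integrable_restrict_space) auto
qed

lemma L2_exp_decay_integrable:
  assumes f: "f \<in> L2_space dual_measure" and a: "0 < a"
  shows "integrable dual_measure (\<lambda>\<xi>. exp (- a * norm \<xi>) * cmod (f \<xi>))"
proof -
  let ?e = "\<lambda>\<xi>::real^'d. complex_of_real (exp (- a * norm \<xi>))"
  have "?e \<in> borel_measurable dual_measure"
    by (intro continuous_measurable_dual continuous_intros)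
  moreover have "integrable dual_measure (\<lambda>\<xi>. (cmod (?e \<xi>))\<^sup>2)"
    using exp_decay_integrable[of "2 * a"] a by (simp add: exp_double[symmetric] mult.assoc flip: exp_of_nat_mult)
  ultimately have "?e \<in> L2_space dual_measure" by (simp add: L2_space_def)
  from L2_space_norm_mult_integrable[OF this f] show ?thesis by simp
qed

text \<open>
  All integrals below are controlled in this way: a square integrable function times an
  exponentially decaying one is integrable by Cauchy--Schwarz, and the second part keeps the constant
  explicit so that it can be used to estimate derivatives.
\<close>

lemma integrable_of_exp_decay:
  fixes k :: "real^'d \<Rightarrow> 'b::{banach, second_countable_topology}"
  assumes f: "f \<in> L2_space dual_measure" and a: "0 < a"
    and k: "k \<in> borel_measurable dual_measure"
    and bound: "\<And>\<xi>. \<xi> \<in> dual_cone \<Omega> \<Longrightarrow> norm (k \<xi>) \<le> c * (exp (- a * norm \<xi>) * cmod (f \<xi>))"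
  shows "integrable dual_measure k"
    "norm (LINT \<xi>|dual_measure. k \<xi>) \<le> c * (LINT \<xi>|dual_measure. exp (- a * norm \<xi>) * cmod (f \<xi>))"
proof -
  let ?g = "\<lambda>\<xi>. c * (exp (- a * norm \<xi>) * cmod (f \<xi>))"
  have g: "integrable dual_measure ?g"
    using L2_exp_decay_integrable[OF f a] by simp
  show k: "integrable dual_measure k"
    by (rule Bochner_Integration.integrable_bound[OF g k])
      (auto intro!: AE_I2 order_trans[OF bound] simp: space_restrict_space)
  have "norm (LINT \<xi>|dual_measure. k \<xi>) \<le> (LINT \<xi>|dual_measure. norm (k \<xi>))"
    by (rule integral_norm_bound)
  also have "\<dots> \<le> (LINT \<xi>|dual_measure. ?g \<xi>)"
  proof (rule integral_mono[OF integrable_norm[OF k] g])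
    show "norm (k \<xi>) \<le> ?g \<xi>" if "\<xi> \<in> space dual_measure" for \<xi>
      using that by (intro bound) (simp add: space_restrict_space)
  qed
  finally show "norm (LINT \<xi>|dual_measure. k \<xi>)
      \<le> c * (LINT \<xi>|dual_measure. exp (- a * norm \<xi>) * cmod (f \<xi>))" by simp
qed

section \<open>Holomorphy of Laplace transforms\<close>

lemma in_tube_iff: "z \<in> tube \<Omega> \<longleftrightarrow> im_part z \<in> \<Omega>"
  by (simp add: tube_def im_part_def)

lemma open_tube: "open (tube \<Omega>)"
proof -
  have "tube \<Omega> = (\<lambda>z. \<chi> j. Im (z $ j)) -` \<Omega>" by (auto simp: tube_def)
  then show ?thesis
    using open_cone by (auto intro!: open_vimage continuous_intros)
qed

lemma laplace_kernel_measurable: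
  "(\<lambda>\<xi>. exp (\<i> * bilin z \<xi>)) \<in> borel_measurable dual_measure"
  by (intro continuous_measurable_dual continuous_intros)

lemma laplace_integrable:
  assumes f: "f \<in> L2_space dual_measure" and z: "z \<in> tube \<Omega>"
  shows "integrable dual_measure (\<lambda>\<xi>. exp (\<i> * bilin z \<xi>) * f \<xi>)"
proof -
  obtain \<epsilon> where \<epsilon>: "0 < \<epsilon>" "\<And>\<xi>. \<xi> \<in> dual_cone \<Omega> \<Longrightarrow> \<epsilon> * norm \<xi> \<le> im_part z \<bullet> \<xi>"
    using dual_cone_coercive z unfolding in_tube_iff by blast
  show ?thesis
  proof (rule integrable_of_exp_decay(1)[OF f \<epsilon>(1), where c = 1])
    show "(\<lambda>\<xi>. exp (\<i> * bilin z \<xi>) * f \<xi>) \<in> borel_measurable dual_measure"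
      using laplace_kernel_measurable L2_space_measurable[OF f] by (rule borel_measurable_times)
  qed (use \<epsilon>(2) in \<open>auto simp: norm_mult Im_bilin intro!: mult_right_mono\<close>)
qed

lemma laplace_add:
  assumes "f \<in> L2_space dual_measure" "g \<in> L2_space dual_measure"
  shows "laplace \<Omega> (\<lambda>\<xi>. f \<xi> + g \<xi>) = (\<lambda>z. laplace \<Omega> f z + laplace \<Omega> g z)"
  using assms[THEN laplace_integrable] by (auto simp: laplace_def ring_distribs)

lemma laplace_diff:
  assumes "f \<in> L2_space dual_measure" "g \<in> L2_space dual_measure"
  shows "laplace \<Omega> (\<lambda>\<xi>. f \<xi> - g \<xi>) = (\<lambda>z. laplace \<Omega> f z - laplace \<Omega> g z)"
  using assms[THEN laplace_integrable] by (auto simp: laplace_def ring_distribs)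

lemma laplace_scale: "laplace \<Omega> (\<lambda>\<xi>. c * f \<xi>) = (\<lambda>z. c * laplace \<Omega> f z)"
  by (auto simp: laplace_def mult.left_commute[of _ c])

lemma laplace_cong_AE:
  assumes "f \<in> borel_measurable dual_measure" "g \<in> borel_measurable dual_measure"
    and "AE \<xi> in dual_measure. f \<xi> = g \<xi>"
  shows "laplace \<Omega> f = laplace \<Omega> g"
proof
  fix z
  show "laplace \<Omega> f z = laplace \<Omega> g z"
    unfolding laplace_def using assms laplace_kernel_measurable[of z]
    by (auto intro!: integral_cong_AE borel_measurable_times)
qed

text \<open>
  The candidate derivative differentiates the kernel under the integral sign. The pointwise
  remainder is quadratic in the increment \<open>h\<close>, with a factor growing at most like
  \<open>\<parallel>\<xi>\<parallel>\<^sup>2 exp (\<parallel>h\<parallel> \<parallel>\<xi>\<parallel>)\<close>; half of the decay of the kernel absorbs this factor as soon as \<open>\<parallel>h\<parallel> \<le> \<epsilon> / 4\<close>, so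
  the remainder of the integral is quadratic in \<open>h\<close> as well.
\<close>

lemma laplace_holomorphic:
  assumes f: "f \<in> L2_space dual_measure"
  shows "holomorphic_several (laplace \<Omega> f) (tube \<Omega>)"
  unfolding holomorphic_several_def
proof
  fix z assume z: "z \<in> tube \<Omega>"
  obtain \<epsilon> where \<epsilon>: "0 < \<epsilon>" "\<And>\<xi>. \<xi> \<in> dual_cone \<Omega> \<Longrightarrow> \<epsilon> * norm \<xi> \<le> im_part z \<bullet> \<xi>"
    using dual_cone_coercive z unfolding in_tube_iff by blast
  define E where "E \<xi> = exp (\<i> * bilin z \<xi>)" for \<xi>
  define I where "I = (LINT \<xi>|dual_measure. exp (- (\<epsilon> / 2) * norm \<xi>) * cmod (f \<xi>))"
  define k where "k h \<xi> = \<i> * bilin h \<xi> * (E \<xi> * f \<xi>)" for h \<xi>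
  define D where "D h = (LINT \<xi>|dual_measure. k h \<xi>)" for h
  have E: "cmod (E \<xi>) \<le> exp (- \<epsilon> * norm \<xi>)" if "\<xi> \<in> dual_cone \<Omega>" for \<xi>
    unfolding E_def norm_exp_bilin using \<epsilon>(2)[OF that] by simp
  have Ef: "(\<lambda>\<xi>. E \<xi> * f \<xi>) \<in> borel_measurable dual_measure"
    unfolding E_def using laplace_kernel_measurable L2_space_measurable[OF f] by (rule borel_measurable_times)
  have bm: "(\<lambda>\<xi>. bilin h \<xi>) \<in> borel_measurable dual_measure" for h
    by (intro continuous_measurable_dual continuous_intros)
  have k_meas: "k h \<in> borel_measurable dual_measure" for h
    unfolding k_def using Ef bm by measurable
  have half: "0 < \<epsilon> / 2" using \<epsilon> by simp
  have k_bound: "cmod (k h \<xi>) \<le> (norm h * (2 / \<epsilon>)) * (exp (- (\<epsilon> / 2) * norm \<xi>) * cmod (f \<xi>))"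
    if "\<xi> \<in> dual_cone \<Omega>" for h \<xi>
  proof -
    have "norm \<xi> \<le> (2 / \<epsilon>) * exp ((\<epsilon> / 2) * norm \<xi>)"
      using exp_ge_add_one_self[of "(\<epsilon> / 2) * norm \<xi>"] \<epsilon>(1) by (simp add: field_simps)
    then have "norm \<xi> * exp (- \<epsilon> * norm \<xi>) \<le> ((2 / \<epsilon>) * exp ((\<epsilon> / 2) * norm \<xi>)) * exp (- \<epsilon> * norm \<xi>)"
      by (rule mult_right_mono) simp
    also have "\<dots> = (2 / \<epsilon>) * exp (- (\<epsilon> / 2) * norm \<xi>)"
      by (simp add: mult.assoc flip: exp_add)
    finally have *: "norm \<xi> * exp (- \<epsilon> * norm \<xi>) \<le> (2 / \<epsilon>) * exp (- (\<epsilon> / 2) * norm \<xi>)" .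
    have "cmod (k h \<xi>) \<le> (norm h * norm \<xi>) * (exp (- \<epsilon> * norm \<xi>) * cmod (f \<xi>))"
    proof -
      have "cmod (k h \<xi>) = cmod (bilin h \<xi>) * (cmod (E \<xi>) * cmod (f \<xi>))"
        by (simp add: k_def norm_mult)
      also have "\<dots> \<le> (norm h * norm \<xi>) * (exp (- \<epsilon> * norm \<xi>) * cmod (f \<xi>))"
        using E[OF that] norm_bilin_le[of h \<xi>]
        by (intro mult_mono[OF _ mult_right_mono] mult_nonneg_nonneg) simp_all
      finally show ?thesis .
    qed
    also have "\<dots> = (norm h * cmod (f \<xi>)) * (norm \<xi> * exp (- \<epsilon> * norm \<xi>))" by simp
    also have "\<dots> \<le> (norm h * cmod (f \<xi>)) * ((2 / \<epsilon>) * exp (- (\<epsilon> / 2) * norm \<xi>))"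
      using * by (rule mult_left_mono) simp
    finally show ?thesis by (simp add: ac_simps)
  qed
  note k_int = integrable_of_exp_decay(1)[OF f half k_meas k_bound]
  have D_bound: "cmod (D h) \<le> norm h * ((2 / \<epsilon>) * I)" for h
    using integrable_of_exp_decay(2)[OF f half k_meas k_bound, of h] by (simp add: D_def I_def mult.assoc)
  have D_add: "D (g + h) = D g + D h" for g h
  proof -
    have "k (g + h) = (\<lambda>\<xi>. k g \<xi> + k h \<xi>)"
      by (simp add: fun_eq_iff k_def bilin_add_left ring_distribs)
    then show ?thesis unfolding D_def using k_int by simp
  qed
  have D_scale: "D (c *s h) = c * D h" for c h
  proof -
    have "k (c *s h) = (\<lambda>\<xi>. c * k h \<xi>)"
      by (simp add: fun_eq_iff k_def bilin_scale_left)
    then show ?thesis unfolding D_def by simp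
  qed
  have D_linear: "bounded_linear D"
  proof (rule bounded_linear_intro[OF D_add _ D_bound])
    show "D (r *\<^sub>R h) = r *\<^sub>R D h" for r h
    proof -
      have "r *\<^sub>R h = complex_of_real r *s h" by (simp add: vec_eq_iff) (simp add: scaleR_conv_of_real)
      then show ?thesis by (simp add: D_scale scaleR_conv_of_real)
    qed
  qed
  have remainder: "cmod (laplace \<Omega> f (z + h) - laplace \<Omega> f z - D h) \<le> ((norm h)\<^sup>2 * (32 / \<epsilon>\<^sup>2)) * I"
    if h: "norm h \<le> \<epsilon> / 4" and zh: "z + h \<in> tube \<Omega>" for h
  proof -
    define r where "r \<xi> = exp (\<i> * bilin (z + h) \<xi>) * f \<xi> - exp (\<i> * bilin z \<xi>) * f \<xi> - k h \<xi>" for \<xi>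
    have r_eq: "r \<xi> = (exp (\<i> * bilin h \<xi>) - 1 - \<i> * bilin h \<xi>) * (E \<xi> * f \<xi>)" for \<xi>
      by (simp add: r_def k_def E_def bilin_add_left ring_distribs exp_add)
    have eq: "laplace \<Omega> f (z + h) - laplace \<Omega> f z - D h = (LINT \<xi>|dual_measure. r \<xi>)"
      unfolding r_def D_def laplace_def using z zh k_int laplace_integrable[OF f z] laplace_integrable[OF f zh]
      by simp
    show ?thesis
      unfolding eq I_def
    proof (rule integrable_of_exp_decay(2)[OF f half])
      show "r \<in> borel_measurable dual_measure"
        unfolding r_eq[abs_def] using Ef bm by measurable
      fix \<xi> assume \<xi>: "\<xi> \<in> dual_cone \<Omega>"
      let ?t = "norm \<xi>"
      have w: "cmod (\<i> * bilin h \<xi>) \<le> norm h * ?t" by (simp add: norm_mult norm_bilin_le)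
      have w': "norm h * ?t \<le> (\<epsilon> / 4) * ?t" using h by (rule mult_right_mono) simp
      \<comment> \<open>The quadratic Taylor term of \<open>exp ((\<epsilon> / 4) * ?t)\<close> is \<open>\<epsilon>\<^sup>2 * ?t\<^sup>2 / 32\<close>.\<close>
      have t2: "?t\<^sup>2 \<le> (32 / \<epsilon>\<^sup>2) * exp ((\<epsilon> / 4) * ?t)"
      proof -
        have "0 \<le> (\<epsilon> / 4) * ?t" using \<epsilon>(1) by simp
        with exp_lower_Taylor_quadratic[OF this]
        have "((\<epsilon> / 4) * ?t)\<^sup>2 / 2 \<le> exp ((\<epsilon> / 4) * ?t)" by linarith
        then show ?thesis using \<epsilon>(1) by (simp add: field_simps power2_eq_square)
      qed
      have "cmod (exp (\<i> * bilin h \<xi>) - 1 - \<i> * bilin h \<xi>)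
          \<le> (cmod (\<i> * bilin h \<xi>))\<^sup>2 * exp (cmod (\<i> * bilin h \<xi>))"
        by (rule exp_remainder_bound)
      also have "\<dots> \<le> (norm h * ?t)\<^sup>2 * exp ((\<epsilon> / 4) * ?t)"
        using w w' by (intro mult_mono power_mono) auto
      also have "\<dots> = ((norm h)\<^sup>2 * exp ((\<epsilon> / 4) * ?t)) * ?t\<^sup>2" by (simp add: power_mult_distrib)
      also have "\<dots> \<le> ((norm h)\<^sup>2 * exp ((\<epsilon> / 4) * ?t)) * ((32 / \<epsilon>\<^sup>2) * exp ((\<epsilon> / 4) * ?t))"
        using t2 by (rule mult_left_mono) simp
      also have "\<dots> = ((norm h)\<^sup>2 * (32 / \<epsilon>\<^sup>2)) * exp ((\<epsilon> / 2) * ?t)"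
        by (simp add: ac_simps flip: exp_add)
      finally have "cmod (r \<xi>) \<le> ((norm h)\<^sup>2 * (32 / \<epsilon>\<^sup>2) * exp ((\<epsilon> / 2) * ?t)) * (exp (- \<epsilon> * ?t) * cmod (f \<xi>))"
        unfolding r_eq norm_mult using E[OF \<xi>] by (intro mult_mono) auto
      also have "\<dots> = (norm h)\<^sup>2 * (32 / \<epsilon>\<^sup>2) * (exp (- (\<epsilon> / 2) * ?t) * cmod (f \<xi>))"
        by (simp add: mult.assoc flip: exp_add)
      finally show "cmod (r \<xi>) \<le> (norm h)\<^sup>2 * (32 / \<epsilon>\<^sup>2) * (exp (- (\<epsilon> / 2) * ?t) * cmod (f \<xi>))" .
    qed
  qed
  have "(laplace \<Omega> f has_derivative D) (at z)"
    unfolding has_derivative_at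
  proof (intro conjI D_linear)
    obtain \<delta> where \<delta>: "0 < \<delta>" "ball z \<delta> \<subseteq> tube \<Omega>"
      using open_tube z open_contains_ball by blast
    show "(\<lambda>h. cmod (laplace \<Omega> f (z + h) - laplace \<Omega> f z - D h) / norm h) \<midarrow>0\<rightarrow> 0"
    proof (rule Lim_null_comparison)
      show "\<forall>\<^sub>F h in at 0. norm (cmod (laplace \<Omega> f (z + h) - laplace \<Omega> f z - D h) / norm h)
          \<le> norm h * ((32 / \<epsilon>\<^sup>2) * I)"
        unfolding eventually_at
      proof (intro exI[of _ "min \<delta> (\<epsilon> / 4)"] conjI ballI impI)
        show "0 < min \<delta> (\<epsilon> / 4)" using \<delta> \<epsilon> by simp
        fix h :: "complex^'d" assume "h \<noteq> 0 \<and> dist h 0 < min \<delta> (\<epsilon> / 4)"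
        then have h: "h \<noteq> 0" "norm h < \<delta>" "norm h \<le> \<epsilon> / 4" by auto
        then have "z + h \<in> tube \<Omega>" by (intro subsetD[OF \<delta>(2)]) (simp add: dist_norm)
        from remainder[OF h(3) this]
        show "norm (cmod (laplace \<Omega> f (z + h) - laplace \<Omega> f z - D h) / norm h) \<le> norm h * ((32 / \<epsilon>\<^sup>2) * I)"
          using h(1) by (simp add: divide_le_eq power2_eq_square ac_simps)
      qed
      show "((\<lambda>h::complex^'d. norm h * ((32 / \<epsilon>\<^sup>2) * I)) \<longlongrightarrow> 0) (at 0)"
        by (intro tendsto_mult_left_zero tendsto_norm_zero tendsto_ident_at)
    qed
  qed
  with D_scale show "\<exists>D. (laplace \<Omega> f has_derivative D) (at z) \<and> (\<forall>c v. D (c *s v) = c * D v)"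
    by blast
qed

end

section \<open>Injectivity of the Laplace transform\<close>

text \<open>
  Continuous functions decreasing to the indicator of a closed set, used to pass from continuous
  test functions to compact sets.
\<close>

lemma bump_tendsto_indicator:
  fixes C :: "'a::metric_space set"
  assumes "closed C" "C \<noteq> {}"
  shows "(\<lambda>n. max 0 (1 - real n * infdist v C)) \<longlonglongrightarrow> indicator C v"
proof (cases "v \<in> C")
  case True
  then have "infdist v C = 0" using in_closed_iff_infdist_zero[OF assms] by blast
  with True show ?thesis by simp
next
  case False
  then have pos: "0 < infdist v C"
    by (metis in_closed_iff_infdist_zero[OF assms] infdist_nonneg order_le_less)
  obtain N :: nat where N: "1 / infdist v C < real N" using reals_Archimedean2 by blast
  have "max 0 (1 - real n * infdist v C) = 0" if "n \<ge> N" for n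
  proof -
    have "1 / infdist v C \<le> real n" using N that by linarith
    then have "1 \<le> real n * infdist v C" using pos by (simp add: divide_le_eq)
    then show ?thesis by simp
  qed
  then have "\<forall>\<^sub>F n in sequentially. max 0 (1 - real n * infdist v C) = 0"
    by (rule eventually_sequentiallyI)
  from tendsto_eventually[OF this] show ?thesis using False by simp
qed

context open_convex_cone
begin

text \<open>
  The functions whose Laplace integral vanishes at all purely imaginary points of the tube. Integrability
  is demanded separately because the integral of a function that is not integrable is zero by
  convention.
\<close>

definition exp_annihilator :: "(real^'d \<Rightarrow> complex) set" where
  "exp_annihilator = {h. \<forall>y\<in>\<Omega>. integrable dual_measure (\<lambda>\<xi>. exp (- (y \<bullet> \<xi>)) *\<^sub>R h \<xi>) \<and>
     (LINT \<xi>|dual_measure. exp (- (y \<bullet> \<xi>)) *\<^sub>R h \<xi>) = 0}"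

lemma exp_annihilator_add:
  "g \<in> exp_annihilator \<Longrightarrow> h \<in> exp_annihilator \<Longrightarrow> (\<lambda>\<xi>. g \<xi> + h \<xi>) \<in> exp_annihilator"
  by (simp add: exp_annihilator_def scaleR_right_distrib)

lemma exp_annihilator_scale:
  "h \<in> exp_annihilator \<Longrightarrow> (\<lambda>\<xi>. r *\<^sub>R h \<xi>) \<in> exp_annihilator"
  by (simp add: exp_annihilator_def scaleR_left_commute[of _ r] del: scaleR_scaleR)

lemma exp_annihilator_sum:
  assumes "finite A" "\<And>a. a \<in> A \<Longrightarrow> h a \<in> exp_annihilator"
  shows "(\<lambda>\<xi>. \<Sum>a\<in>A. h a \<xi>) \<in> exp_annihilator"
  using assms by (induction A rule: finite_induct) (simp_all add: exp_annihilator_add, simp add: exp_annihilator_def)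

lemma exp_annihilator_exp:
  assumes "h \<in> exp_annihilator" "y \<in> \<Omega>"
  shows "(\<lambda>\<xi>. exp (- (y \<bullet> \<xi>)) *\<^sub>R h \<xi>) \<in> exp_annihilator"
  unfolding exp_annihilator_def
proof (intro CollectI ballI)
  fix x assume "x \<in> \<Omega>"
  then have "x + y \<in> \<Omega>" using assms(2) by (rule cone_add)
  moreover have "(\<lambda>\<xi>. exp (- (x \<bullet> \<xi>)) *\<^sub>R exp (- (y \<bullet> \<xi>)) *\<^sub>R h \<xi>) = (\<lambda>\<xi>. exp (- ((x + y) \<bullet> \<xi>)) *\<^sub>R h \<xi>)"
    by (simp add: inner_add_left flip: exp_add)
  ultimately show "integrable dual_measure (\<lambda>\<xi>. exp (- (x \<bullet> \<xi>)) *\<^sub>R exp (- (y \<bullet> \<xi>)) *\<^sub>R h \<xi>) \<and>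
      (LINT \<xi>|dual_measure. exp (- (x \<bullet> \<xi>)) *\<^sub>R exp (- (y \<bullet> \<xi>)) *\<^sub>R h \<xi>) = 0"
    using assms(1) by (simp add: exp_annihilator_def)
qed

text \<open>
  Multiplication by a fixed exponential preserves the annihilator (\<open>exp_annihilator_exp\<close>), and the
  functions with this property form an algebra. Letting \<open>h\<close> vary in the induction is what makes
  the product step immediate.
\<close>

lemma exp_annihilator_polynomial:
  fixes y :: "'k::finite \<Rightarrow> real^'d"
  assumes y: "\<And>k. y k \<in> \<Omega>" and "real_polynomial_function p" and "h \<in> exp_annihilator"
  shows "(\<lambda>\<xi>. p (\<chi> k. exp (- (y k \<bullet> \<xi>))) *\<^sub>R h \<xi>) \<in> exp_annihilator"
  using assms(2,3)
proof (induction arbitrary: h rule: real_polynomial_function.induct)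
  case (linear f)
  interpret bounded_linear f by fact
  have f_coords: "f v = (\<Sum>k\<in>UNIV. f (axis k 1) * v $ k)" for v :: "real^'k"
  proof -
    have "f v = f (\<Sum>k\<in>UNIV. v $ k *s axis k 1)" by (simp only: basis_expansion)
    also have "\<dots> = (\<Sum>k\<in>UNIV. f (axis k 1) * v $ k)"
      by (simp add: sum scaleR scalar_mult_eq_scaleR mult.commute)
    finally show ?thesis .
  qed
  have "(\<lambda>\<xi>. f (\<chi> k. exp (- (y k \<bullet> \<xi>))) *\<^sub>R h \<xi>)
      = (\<lambda>\<xi>. \<Sum>k\<in>UNIV. f (axis k 1) *\<^sub>R (exp (- (y k \<bullet> \<xi>)) *\<^sub>R h \<xi>))"
    by (subst f_coords) (simp add: scaleR_sum_left)
  then show ?case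
    by (simp only:) (intro exp_annihilator_sum exp_annihilator_scale exp_annihilator_exp linear.prems y finite)
next
  case (const c)
  then show ?case by (simp add: exp_annihilator_scale)
next
  case (add f g)
  from exp_annihilator_add[OF add.IH[OF add.prems]] show ?case by (simp add: scaleR_left_distrib)
next
  case (mult f g)
  from mult.IH(1)[OF mult.IH(2)[OF mult.prems]] show ?case by simp
qed

text \<open>
  On the dual cone all the exponentials take values in the unit interval, so \<open>\<phi>\<close> only matters on a cube,
  where polynomials approximate it uniformly.
\<close>

lemma exp_annihilator_continuous:
  fixes y :: "'k::finite \<Rightarrow> real^'d"
  assumes y: "\<And>k. y k \<in> \<Omega>" and h: "h \<in> exp_annihilator" and x: "x \<in> \<Omega>"
    and \<phi>: "continuous_on UNIV \<phi>"
  shows "(LINT \<xi>|dual_measure. \<phi> (\<chi> k. exp (- (y k \<bullet> \<xi>))) *\<^sub>R (exp (- (x \<bullet> \<xi>)) *\<^sub>R h \<xi>)) = 0"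
    (is "?I = 0")
proof -
  let ?\<Phi> = "\<lambda>\<xi>. \<chi> k. exp (- (y k \<bullet> \<xi>))"
  let ?g = "\<lambda>\<xi>. exp (- (x \<bullet> \<xi>)) *\<^sub>R h \<xi>"
  let ?Q = "cbox 0 (\<chi> k. 1) :: (real^'k) set"
  have Q: "?\<Phi> \<xi> \<in> ?Q" if "\<xi> \<in> dual_cone \<Omega>" for \<xi>
    using that y by (auto simp: mem_box_cart dual_cone_def)
  have g: "integrable dual_measure ?g" using h x by (simp add: exp_annihilator_def)
  define A where "A = (LINT \<xi>|dual_measure. norm (?g \<xi>))"
  have A: "0 \<le> A" unfolding A_def by simp
  have bound: "cmod ?I \<le> e * A" if e: "0 < e" for e
  proof -
    obtain p where p: "real_polynomial_function p" "\<And>v. v \<in> ?Q \<Longrightarrow> \<bar>\<phi> v - p v\<bar> < e"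
      using Stone_Weierstrass_real_polynomial_function[OF compact_cbox continuous_on_subset[OF \<phi>] e]
      by blast
    have pg: "integrable dual_measure (\<lambda>\<xi>. p (?\<Phi> \<xi>) *\<^sub>R ?g \<xi>)"
      "(LINT \<xi>|dual_measure. p (?\<Phi> \<xi>) *\<^sub>R ?g \<xi>) = 0"
      using exp_annihilator_polynomial[OF y p(1) h] x
      by (simp_all add: exp_annihilator_def mult.commute)
    have "continuous_on UNIV p"
      using p(1) by (intro continuous_on_polymonial_function) (simp add: real_polynomial_function_eq)
    then have "continuous_on UNIV (\<lambda>v. \<phi> v - p v)" using \<phi> by (intro continuous_on_diff)
    moreover have "continuous_on (dual_cone \<Omega>) ?\<Phi>" by (intro continuous_intros)
    ultimately have m: "(\<lambda>\<xi>. \<phi> (?\<Phi> \<xi>) - p (?\<Phi> \<xi>)) \<in> borel_measurable dual_measure"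
      by (intro continuous_measurable_dual) (rule continuous_on_compose2[where t = UNIV], auto)
    have le: "norm ((\<phi> (?\<Phi> \<xi>) - p (?\<Phi> \<xi>)) *\<^sub>R ?g \<xi>) \<le> e * norm (?g \<xi>)" if "\<xi> \<in> dual_cone \<Omega>" for \<xi>
      unfolding norm_scaleR using p(2)[OF Q[OF that]] by (intro mult_right_mono) auto
    have d: "integrable dual_measure (\<lambda>\<xi>. (\<phi> (?\<Phi> \<xi>) - p (?\<Phi> \<xi>)) *\<^sub>R ?g \<xi>)"
    proof (rule Bochner_Integration.integrable_bound)
      show "integrable dual_measure (\<lambda>\<xi>. e *\<^sub>R norm (?g \<xi>))" using g by (intro integrable_scaleR_right integrable_norm)
      show "(\<lambda>\<xi>. (\<phi> (?\<Phi> \<xi>) - p (?\<Phi> \<xi>)) *\<^sub>R ?g \<xi>) \<in> borel_measurable dual_measure"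
        using m borel_measurable_integrable[OF g] by (rule borel_measurable_scaleR)
      show "AE \<xi> in dual_measure. norm ((\<phi> (?\<Phi> \<xi>) - p (?\<Phi> \<xi>)) *\<^sub>R ?g \<xi>) \<le> norm (e *\<^sub>R norm (?g \<xi>))"
      proof (rule AE_I2)
        fix \<xi> assume "\<xi> \<in> space dual_measure"
        then have "\<xi> \<in> dual_cone \<Omega>" by (simp add: space_restrict_space)
        from le[OF this] show "norm ((\<phi> (?\<Phi> \<xi>) - p (?\<Phi> \<xi>)) *\<^sub>R ?g \<xi>) \<le> norm (e *\<^sub>R norm (?g \<xi>))"
          using e by (simp add: abs_mult)
      qed
    qed
    have "?I = (LINT \<xi>|dual_measure. p (?\<Phi> \<xi>) *\<^sub>R ?g \<xi> + (\<phi> (?\<Phi> \<xi>) - p (?\<Phi> \<xi>)) *\<^sub>R ?g \<xi>)"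
      by (simp only: scaleR_left_distrib[symmetric] add_diff_cancel_left' add_diff_eq)
    also have "\<dots> = (LINT \<xi>|dual_measure. (\<phi> (?\<Phi> \<xi>) - p (?\<Phi> \<xi>)) *\<^sub>R ?g \<xi>)"
      using Bochner_Integration.integral_add[OF pg(1) d] pg(2) by simp
    also have "cmod \<dots> \<le> (LINT \<xi>|dual_measure. e * norm (?g \<xi>))"
    proof (rule order_trans[OF integral_norm_bound integral_mono[OF integrable_norm[OF d]]])
      show "integrable dual_measure (\<lambda>\<xi>. e * norm (?g \<xi>))"
        using g by (intro integrable_mult_right integrable_norm)
      show "norm ((\<phi> (?\<Phi> \<xi>) - p (?\<Phi> \<xi>)) *\<^sub>R ?g \<xi>) \<le> e * norm (?g \<xi>)"
        if "\<xi> \<in> space dual_measure" for \<xi>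
        using that by (intro le) (simp add: space_restrict_space)
    qed
    finally show ?thesis by (simp add: A_def)
  qed
  have "cmod ?I \<le> 0"
  proof (rule field_le_epsilon)
    fix e :: real assume e: "0 < e"
    have "cmod ?I \<le> e / (A + 1) * A" using e A by (intro bound divide_pos_pos) auto
    also have "\<dots> \<le> e" using e A by (simp add: divide_le_eq)
    finally show "cmod ?I \<le> 0 + e" by simp
  qed
  then show ?thesis by simp
qed

text \<open>
  Take the exponentials of an interior point \<open>x\<close> of the cone and of its translates by small multiples
  of the unit vectors. They determine \<open>\<xi>\<close>, so a compact set \<open>K\<close> is the preimage of its compact image and
  the indicator of \<open>K\<close> is a limit of continuous functions of these exponentials.
\<close>

lemma exp_annihilator_AE_zero:
  assumes h: "h \<in> exp_annihilator"
  shows "AE \<xi> in dual_measure. h \<xi> = 0"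
proof -
  obtain x where x: "x \<in> \<Omega>" using nonempty by blast
  then obtain c where c: "0 < c" "cball x c \<subseteq> \<Omega>"
    using open_cone open_contains_cball by blast
  \<comment> \<open>The index \<open>None\<close> carries the base point, whose pairing with \<open>\<xi>\<close> has to be subtracted from the
    others to recover the coordinates.\<close>
  define y :: "'d option \<Rightarrow> real^'d" where
    "y k = (case k of None \<Rightarrow> x | Some j \<Rightarrow> x + c *\<^sub>R axis j 1)" for k
  have y: "y k \<in> \<Omega>" for k
    using c x by (cases k) (auto simp: y_def dist_norm norm_axis_1 intro!: subsetD[OF c(2)])
  define \<Phi> :: "real^'d \<Rightarrow> real^'d option" where "\<Phi> \<xi> = (\<chi> k. exp (- (y k \<bullet> \<xi>)))" for \<xi>
  have inj: "\<xi> = \<xi>'" if "\<Phi> \<xi> = \<Phi> \<xi>'" for \<xi> \<xi>'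
  proof -
    have *: "y k \<bullet> \<xi> = y k \<bullet> \<xi>'" for k
      using that by (auto simp: \<Phi>_def vec_eq_iff)
    have "\<xi> $ j = \<xi>' $ j" for j
      using *[of None] *[of "Some j"] c(1) by (simp add: y_def inner_add_left inner_axis')
    then show ?thesis by (simp add: vec_eq_iff)
  qed
  have cont: "continuous_on S \<Phi>" for S
    unfolding \<Phi>_def by (intro continuous_intros)
  let ?g = "\<lambda>\<xi>. exp (- (x \<bullet> \<xi>)) *\<^sub>R h \<xi>"
  have g: "integrable dual_measure ?g" using h x by (simp add: exp_annihilator_def)
  note g_meas = borel_measurable_integrable[OF g]
  have "AE \<xi> in dual_measure. ?g \<xi> = 0"
  proof (rule AE_zero_if_compact_integrals_zero[OF dual_cone_sets g])
    fix K assume K: "compact K" "K \<subseteq> dual_cone \<Omega>"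
    show "(LINT \<xi>:K|dual_measure. ?g \<xi>) = 0"
    proof (cases "K = {}")
      case False
      let ?C = "\<Phi> ` K"
      have C: "closed ?C" "?C \<noteq> {}"
        using False K(1) by (auto intro!: compact_imp_closed compact_continuous_image cont)
      have mem: "\<Phi> \<xi> \<in> ?C \<longleftrightarrow> \<xi> \<in> K" for \<xi> using inj by blast
      define b where "b n v = max 0 (1 - real n * infdist v ?C)" for n v
      have b_cont: "continuous_on S (b n)" for n S
        unfolding b_def by (intro continuous_intros)
      have "(\<lambda>n. LINT \<xi>|dual_measure. b n (\<Phi> \<xi>) *\<^sub>R ?g \<xi>)
          \<longlonglongrightarrow> (LINT \<xi>|dual_measure. indicator K \<xi> *\<^sub>R ?g \<xi>)"
      proof (rule integral_dominated_convergence)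
        show "(\<lambda>\<xi>. indicator K \<xi> *\<^sub>R ?g \<xi>) \<in> borel_measurable dual_measure"
        proof (rule borel_measurable_scaleR[OF borel_measurable_indicator g_meas])
          show "K \<in> sets dual_measure"
            using K dual_cone_sets lmeasurable_compact[of K] by (auto simp: sets_restrict_space_iff fmeasurableD)
        qed
        show "(\<lambda>\<xi>. b n (\<Phi> \<xi>) *\<^sub>R ?g \<xi>) \<in> borel_measurable dual_measure" for n
          by (rule borel_measurable_scaleR[OF continuous_measurable_dual g_meas])
            (rule continuous_on_compose2[OF b_cont cont], auto)
        show "integrable dual_measure (\<lambda>\<xi>. norm (?g \<xi>))" using g by (rule integrable_norm)
        show "AE \<xi> in dual_measure. (\<lambda>n. b n (\<Phi> \<xi>) *\<^sub>R ?g \<xi>) \<longlonglongrightarrow> indicator K \<xi> *\<^sub>R ?g \<xi>"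
        proof (rule AE_I2)
          fix \<xi>
          have "(\<lambda>n. b n (\<Phi> \<xi>)) \<longlonglongrightarrow> indicator K \<xi>"
            using bump_tendsto_indicator[OF C, of "\<Phi> \<xi>"] mem[of \<xi>] by (simp add: b_def indicator_def)
          then show "(\<lambda>n. b n (\<Phi> \<xi>) *\<^sub>R ?g \<xi>) \<longlonglongrightarrow> indicator K \<xi> *\<^sub>R ?g \<xi>"
            by (intro tendsto_intros)
        qed
        show "AE \<xi> in dual_measure. norm (b n (\<Phi> \<xi>) *\<^sub>R ?g \<xi>) \<le> norm (?g \<xi>)" for n
        proof (rule AE_I2)
          fix \<xi>
          have "\<bar>b n (\<Phi> \<xi>)\<bar> \<le> 1" by (simp add: b_def infdist_nonneg)
          then have "\<bar>b n (\<Phi> \<xi>)\<bar> * norm (?g \<xi>) \<le> 1 * norm (?g \<xi>)" by (rule mult_right_mono) simp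
          then show "norm (b n (\<Phi> \<xi>) *\<^sub>R ?g \<xi>) \<le> norm (?g \<xi>)" by (simp only: norm_scaleR mult_1)
        qed
      qed
      moreover have "(LINT \<xi>|dual_measure. b n (\<Phi> \<xi>) *\<^sub>R ?g \<xi>) = 0" for n
        unfolding \<Phi>_def using y h x b_cont by (rule exp_annihilator_continuous)
      ultimately show ?thesis
        by (simp add: set_lebesgue_integral_def LIMSEQ_const_iff)
    qed (simp add: set_lebesgue_integral_def)
  qed
  then show ?thesis by eventually_elim simp
qed

text \<open>
  On purely imaginary points of the tube the Laplace kernel is a real exponential, so the difference of
  two functions with equal transforms lies in the annihilator.
\<close>

theorem laplace_injective:
  assumes f: "f \<in> L2_space dual_measure" and g: "g \<in> L2_space dual_measure"
    and eq: "laplace \<Omega> f = laplace \<Omega> g"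
  shows "AE \<xi> in dual_measure. f \<xi> = g \<xi>"
proof -
  have "(\<lambda>\<xi>. f \<xi> - g \<xi>) \<in> exp_annihilator"
    unfolding exp_annihilator_def
  proof (intro CollectI ballI)
    fix y assume y: "y \<in> \<Omega>"
    define z :: "complex^'d" where "z = (\<chi> j. \<i> * of_real (y $ j))"
    have "im_part z = y" by (simp add: im_part_def z_def vec_eq_iff)
    then have z: "z \<in> tube \<Omega>" using y by (simp add: in_tube_iff)
    have "bilin z \<xi> = \<i> * of_real (y \<bullet> \<xi>)" for \<xi>
      by (simp add: bilin_def z_def inner_vec_def sum_distrib_left mult.assoc)
    then have e: "exp (- (y \<bullet> \<xi>)) *\<^sub>R (f \<xi> - g \<xi>) = exp (\<i> * bilin z \<xi>) * (f \<xi> - g \<xi>)" for \<xi>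
      by (simp add: scaleR_conv_of_real flip: exp_of_real)
    have d: "(\<lambda>\<xi>. f \<xi> - g \<xi>) \<in> L2_space dual_measure" using f g by (rule L2_space_diff)
    show "integrable dual_measure (\<lambda>\<xi>. exp (- (y \<bullet> \<xi>)) *\<^sub>R (f \<xi> - g \<xi>)) \<and>
        (LINT \<xi>|dual_measure. exp (- (y \<bullet> \<xi>)) *\<^sub>R (f \<xi> - g \<xi>)) = 0"
      unfolding e
    proof
      show "integrable dual_measure (\<lambda>\<xi>. exp (\<i> * bilin z \<xi>) * (f \<xi> - g \<xi>))"
        using d z by (rule laplace_integrable)
      have "laplace \<Omega> (\<lambda>\<xi>. f \<xi> - g \<xi>) z = 0"
        using laplace_diff[OF f g] eq by simp
      then show "(LINT \<xi>|dual_measure. exp (\<i> * bilin z \<xi>) * (f \<xi> - g \<xi>)) = 0"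
        using z by (simp add: laplace_def)
    qed
  qed
  from exp_annihilator_AE_zero[OF this] show ?thesis by eventually_elim simp
qed

end

section \<open>The Hardy--Sobolev space as a Hilbert space\<close>

locale hardy_sobolev_space = open_convex_cone \<Omega> for \<Omega> :: "(real^'d) set" +
  fixes \<rho> :: "real^'d \<Rightarrow> real" and n :: nat
  assumes continuous_\<rho>: "continuous_on (dual_cone \<Omega>) \<rho>"
begin

abbreviation H :: "(complex^'d \<Rightarrow> complex) set" where
  "H \<equiv> hardy_sobolev \<Omega> \<rho> n"

lemma weight_ge_1: "1 \<le> weight \<rho> n \<xi>"
proof -
  have "(\<Sum>k\<in>{0}. \<rho> \<xi> ^ (2 * k)) \<le> weight \<rho> n \<xi>"
    unfolding weight_def by (rule sum_mono2) (simp_all add: power_mult)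
  then show ?thesis by simp
qed

lemma weight_pos: "0 < weight \<rho> n \<xi>"
  using weight_ge_1[of \<xi>] by linarith

lemma continuous_weight: "continuous_on (dual_cone \<Omega>) (weight \<rho> n)"
  unfolding weight_def by (intro continuous_intros continuous_\<rho>)

lemma sqrt_weight_measurable:
  "(\<lambda>\<xi>. complex_of_real (sqrt (weight \<rho> n \<xi>))) \<in> borel_measurable dual_measure"
  by (intro continuous_measurable_dual continuous_intros continuous_weight)

lemma sqrt_weight_nonzero: "complex_of_real (sqrt (weight \<rho> n \<xi>)) \<noteq> 0"
  using weight_pos[of \<xi>] by simp

lemma L2_weighted_iff:
  "f \<in> L2_weighted \<Omega> \<rho> n \<longleftrightarrow> (\<lambda>\<xi>. f \<xi> * of_real (sqrt (weight \<rho> n \<xi>))) \<in> L2_space dual_measure"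
proof -
  let ?s = "\<lambda>\<xi>. complex_of_real (sqrt (weight \<rho> n \<xi>))"
  have div: "f \<in> borel_measurable dual_measure"
    if "(\<lambda>\<xi>. f \<xi> * ?s \<xi>) \<in> borel_measurable dual_measure"
  proof -
    have "(\<lambda>\<xi>. f \<xi> * ?s \<xi> / ?s \<xi>) = f"
      using sqrt_weight_nonzero by (intro ext nonzero_mult_div_cancel_right)
    with borel_measurable_divide[OF that sqrt_weight_measurable] show ?thesis by (simp only:)
  qed
  have sq: "(cmod (f \<xi> * ?s \<xi>))\<^sup>2 = (cmod (f \<xi>))\<^sup>2 * weight \<rho> n \<xi>" for \<xi>
    using weight_pos[of \<xi>] by (simp add: norm_mult power_mult_distrib)
  show ?thesis
    unfolding L2_weighted_def L2_space_def mem_Collect_eq sq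
    using div borel_measurable_times[OF _ sqrt_weight_measurable, of f] by blast
qed

lemma L2_weighted_imp_L2:
  assumes "f \<in> L2_weighted \<Omega> \<rho> n"
  shows "f \<in> L2_space dual_measure"
proof -
  have f: "f \<in> borel_measurable dual_measure"
    and i: "integrable dual_measure (\<lambda>\<xi>. (cmod (f \<xi>))\<^sup>2 * weight \<rho> n \<xi>)"
    using assms by (auto simp: L2_weighted_def)
  have "integrable dual_measure (\<lambda>\<xi>. (cmod (f \<xi>))\<^sup>2)"
  proof (rule Bochner_Integration.integrable_bound[OF i])
    have "(cmod (f \<xi>))\<^sup>2 * 1 \<le> (cmod (f \<xi>))\<^sup>2 * weight \<rho> n \<xi>" for \<xi>
      using weight_ge_1 by (rule mult_left_mono) simp
    then show "AE \<xi> in dual_measure. norm ((cmod (f \<xi>))\<^sup>2) \<le> norm ((cmod (f \<xi>))\<^sup>2 * weight \<rho> n \<xi>)"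
      using weight_pos by (auto simp: abs_mult abs_of_pos)
  qed (use f in measurable)
  with f show ?thesis by (simp add: L2_space_def)
qed

lemma hardy_sobolev_iff: "F \<in> H \<longleftrightarrow> (\<exists>f\<in>L2_weighted \<Omega> \<rho> n. F = laplace \<Omega> f)"
  using laplace_holomorphic[OF L2_weighted_imp_L2] by (auto simp: hardy_sobolev_def)

lemma laplace_inv_spec:
  assumes "F \<in> H"
  shows "laplace_inv \<Omega> \<rho> n F \<in> L2_weighted \<Omega> \<rho> n" "F = laplace \<Omega> (laplace_inv \<Omega> \<rho> n F)"
proof -
  have "\<exists>f. f \<in> L2_weighted \<Omega> \<rho> n \<and> F = laplace \<Omega> f"
    using assms by (auto simp: hardy_sobolev_iff)
  from someI_ex[OF this]
  show "laplace_inv \<Omega> \<rho> n F \<in> L2_weighted \<Omega> \<rho> n" "F = laplace \<Omega> (laplace_inv \<Omega> \<rho> n F)"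
    by (simp_all add: laplace_inv_def)
qed

text \<open>
  The isometry from the Hardy--Sobolev space to the unweighted \<open>L\<^sup>2\<close> space of the dual cone; the square
  root of the weight moves the weight from the measure into the function. It inverts \<open>synthesis\<close> almost
  everywhere, which is where injectivity of the Laplace transform enters.
\<close>

definition analysis :: "(complex^'d \<Rightarrow> complex) \<Rightarrow> real^'d \<Rightarrow> complex" where
  "analysis F \<xi> = laplace_inv \<Omega> \<rho> n F \<xi> * of_real (sqrt (weight \<rho> n \<xi>))"

definition synthesis :: "(real^'d \<Rightarrow> complex) \<Rightarrow> complex^'d \<Rightarrow> complex" where
  "synthesis u = laplace \<Omega> (\<lambda>\<xi>. u \<xi> / of_real (sqrt (weight \<rho> n \<xi>)))"

lemma analysis_L2: "F \<in> H \<Longrightarrow> analysis F \<in> L2_space dual_measure"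
  using laplace_inv_spec(1)[of F] by (simp add: L2_weighted_iff analysis_def[abs_def])

lemma L2_divide_sqrt_weight:
  assumes "u \<in> L2_space dual_measure"
  shows "(\<lambda>\<xi>. u \<xi> / of_real (sqrt (weight \<rho> n \<xi>))) \<in> L2_weighted \<Omega> \<rho> n"
  using assms sqrt_weight_nonzero by (simp add: L2_weighted_iff)

lemma synthesis_in: "u \<in> L2_space dual_measure \<Longrightarrow> synthesis u \<in> H"
  using L2_divide_sqrt_weight by (auto simp: hardy_sobolev_iff synthesis_def)

lemma synthesis_analysis: "F \<in> H \<Longrightarrow> synthesis (analysis F) = F"
  using laplace_inv_spec(2)[of F, symmetric] sqrt_weight_nonzero by (simp add: synthesis_def analysis_def)

lemma analysis_synthesis:
  assumes u: "u \<in> L2_space dual_measure"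
  shows "AE \<xi> in dual_measure. analysis (synthesis u) \<xi> = u \<xi>"
proof -
  let ?f = "\<lambda>\<xi>. u \<xi> / of_real (sqrt (weight \<rho> n \<xi>))"
  have "AE \<xi> in dual_measure. laplace_inv \<Omega> \<rho> n (synthesis u) \<xi> = ?f \<xi>"
  proof (rule laplace_injective)
    show "laplace_inv \<Omega> \<rho> n (synthesis u) \<in> L2_space dual_measure"
      by (intro L2_weighted_imp_L2 laplace_inv_spec(1) synthesis_in u)
    show "?f \<in> L2_space dual_measure"
      by (intro L2_weighted_imp_L2 L2_divide_sqrt_weight u)
    show "laplace \<Omega> (laplace_inv \<Omega> \<rho> n (synthesis u)) = laplace \<Omega> ?f"
      using laplace_inv_spec(2)[OF synthesis_in[OF u], symmetric] by (simp add: synthesis_def)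
  qed
  then show ?thesis
    by eventually_elim (use sqrt_weight_nonzero in \<open>simp add: analysis_def\<close>)
qed

lemma synthesis_add:
  assumes "u \<in> L2_space dual_measure" "v \<in> L2_space dual_measure"
  shows "synthesis (\<lambda>\<xi>. u \<xi> + v \<xi>) = (\<lambda>z. synthesis u z + synthesis v z)"
  using laplace_add[OF assms[THEN L2_divide_sqrt_weight, THEN L2_weighted_imp_L2]]
  by (simp add: synthesis_def add_divide_distrib)

lemma synthesis_scale: "synthesis (\<lambda>\<xi>. c * u \<xi>) = (\<lambda>z. c * synthesis u z)"
  using laplace_scale[of c "\<lambda>\<xi>. u \<xi> / of_real (sqrt (weight \<rho> n \<xi>))"] by (simp add: synthesis_def)

lemma H_add:
  assumes "F \<in> H" "G \<in> H"
  shows "(\<lambda>z. F z + G z) \<in> H"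
  using synthesis_in[OF L2_space_add[OF assms[THEN analysis_L2]]] assms
  by (simp add: synthesis_add analysis_L2 synthesis_analysis)

lemma H_scale:
  assumes "F \<in> H"
  shows "(\<lambda>z. c * F z) \<in> H"
  using synthesis_in[OF L2_space_scale[OF analysis_L2[OF assms], of c]] assms
  by (simp add: synthesis_scale synthesis_analysis)

lemma hs_inner_eq:
  "hs_inner \<Omega> \<rho> n F G = L2_inner dual_measure (analysis F) (analysis G)"
proof -
  have "analysis F \<xi> * cnj (analysis G \<xi>)
      = laplace_inv \<Omega> \<rho> n F \<xi> * cnj (laplace_inv \<Omega> \<rho> n G \<xi>) * of_real (weight \<rho> n \<xi>)" for \<xi>
  proof -
    have "complex_of_real (weight \<rho> n \<xi>) = of_real (sqrt (weight \<rho> n \<xi>)) * of_real (sqrt (weight \<rho> n \<xi>))"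
      using weight_pos[of \<xi>] by (simp flip: of_real_mult)
    then show ?thesis by (simp add: analysis_def)
  qed
  then show ?thesis by (simp add: hs_inner_def L2_inner_def)
qed

lemma hs_norm_eq: "hs_norm \<Omega> \<rho> n F = L2_norm dual_measure (analysis F)"
  by (simp add: hs_norm_def hs_inner_eq L2_inner_self L2_norm_nonneg flip: of_real_power)

lemma hs_norm_nonneg: "0 \<le> hs_norm \<Omega> \<rho> n F"
  by (simp add: hs_norm_eq L2_norm_nonneg)

text \<open>
  Linearity of the inner product cannot be read off from its definition, since the chosen preimage of a sum
  need not be the sum of the chosen preimages. These rules replace the chosen preimage by
  any other one.
\<close>

lemma hs_inner_synthesis:
  assumes "F \<in> H" "u \<in> L2_space dual_measure"
  shows "hs_inner \<Omega> \<rho> n F (synthesis u) = L2_inner dual_measure (analysis F) u"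
    "hs_inner \<Omega> \<rho> n (synthesis u) F = L2_inner dual_measure u (analysis F)"
  unfolding hs_inner_eq using assms
  by (auto intro!: L2_inner_cong_AE analysis_synthesis L2_space_measurable analysis_L2 synthesis_in)

lemma hs_inner_commute: "hs_inner \<Omega> \<rho> n G F = cnj (hs_inner \<Omega> \<rho> n F G)"
  unfolding hs_inner_eq by (rule L2_inner_commute)

lemma hs_inner_self: "hs_inner \<Omega> \<rho> n F F = of_real ((hs_norm \<Omega> \<rho> n F)\<^sup>2)"
  by (simp add: hs_inner_eq hs_norm_eq L2_inner_self)

lemma hs_Cauchy_Schwarz:
  "F \<in> H \<Longrightarrow> G \<in> H \<Longrightarrow> cmod (hs_inner \<Omega> \<rho> n F G) \<le> hs_norm \<Omega> \<rho> n F * hs_norm \<Omega> \<rho> n G"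
  unfolding hs_inner_eq hs_norm_eq by (intro L2_Cauchy_Schwarz analysis_L2)

lemma hs_inner_add_left:
  assumes "F \<in> H" "G \<in> H" "K \<in> H"
  shows "hs_inner \<Omega> \<rho> n (\<lambda>z. F z + G z) K = hs_inner \<Omega> \<rho> n F K + hs_inner \<Omega> \<rho> n G K"
proof -
  have "(\<lambda>z. F z + G z) = synthesis (\<lambda>\<xi>. analysis F \<xi> + analysis G \<xi>)"
    using assms by (simp add: synthesis_add analysis_L2 synthesis_analysis)
  then have "hs_inner \<Omega> \<rho> n (\<lambda>z. F z + G z) K
      = L2_inner dual_measure (\<lambda>\<xi>. analysis F \<xi> + analysis G \<xi>) (analysis K)"
    using assms by (simp add: hs_inner_synthesis L2_space_add analysis_L2)
  also have "\<dots> = hs_inner \<Omega> \<rho> n F K + hs_inner \<Omega> \<rho> n G K"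
    unfolding hs_inner_eq by (intro L2_inner_add_left analysis_L2 assms)
  finally show ?thesis .
qed

lemma hs_inner_scale_left:
  assumes "F \<in> H" "K \<in> H"
  shows "hs_inner \<Omega> \<rho> n (\<lambda>z. c * F z) K = c * hs_inner \<Omega> \<rho> n F K"
proof -
  have "(\<lambda>z. c * F z) = synthesis (\<lambda>\<xi>. c * analysis F \<xi>)"
    using assms by (simp add: synthesis_scale synthesis_analysis)
  then have "hs_inner \<Omega> \<rho> n (\<lambda>z. c * F z) K
      = L2_inner dual_measure (\<lambda>\<xi>. c * analysis F \<xi>) (analysis K)"
    using assms by (simp add: hs_inner_synthesis L2_space_scale analysis_L2)
  also have "\<dots> = c * hs_inner \<Omega> \<rho> n F K"
    unfolding hs_inner_eq by (rule L2_inner_scale_left)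
  finally show ?thesis .
qed

text \<open>
  Equality here is equality of functions on the tube: a vector of norm zero has a preimage
  vanishing almost everywhere, and its Laplace transform vanishes at every point.
\<close>

lemma hs_inner_nondegenerate:
  assumes F: "F \<in> H" and G: "G \<in> H"
    and eq: "\<And>K. K \<in> H \<Longrightarrow> hs_inner \<Omega> \<rho> n F K = hs_inner \<Omega> \<rho> n G K"
  shows "F = G"
proof -
  define D where "D = (\<lambda>z. F z + (-1) * G z)"
  have D: "D \<in> H" unfolding D_def by (intro H_add H_scale F G)
  have "hs_inner \<Omega> \<rho> n D D = 0"
    using eq[OF D] hs_inner_add_left[OF F H_scale[OF G, of "-1"] D, folded D_def]
      hs_inner_scale_left[OF G D, of "-1"] by simp
  then have "L2_norm dual_measure (analysis D) = 0"
    by (simp add: hs_inner_self hs_norm_eq)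
  then have ae: "AE \<xi> in dual_measure. analysis D \<xi> = 0"
    using analysis_L2[OF D] by (intro L2_norm_eq_0_AE)
  have "D = synthesis (analysis D)" using synthesis_analysis[OF D] ..
  also have "\<dots> = laplace \<Omega> (\<lambda>\<xi>. 0)"
    unfolding synthesis_def
  proof (rule laplace_cong_AE)
    show "(\<lambda>\<xi>. analysis D \<xi> / of_real (sqrt (weight \<rho> n \<xi>))) \<in> borel_measurable dual_measure"
      using D by (intro L2_space_measurable L2_weighted_imp_L2 L2_divide_sqrt_weight analysis_L2)
    show "AE \<xi> in dual_measure. analysis D \<xi> / of_real (sqrt (weight \<rho> n \<xi>)) = 0"
      using ae by eventually_elim simp
  qed simp
  also have "\<dots> = (\<lambda>z. 0)" by (auto simp: laplace_def)
  finally show ?thesis by (simp add: D_def fun_eq_iff)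
qed

text \<open>
  The composition of \<open>\<phi>\<close> with \<open>synthesis\<close> is linear on the whole of \<open>L\<^sup>2\<close>, and it does not distinguish functions that are
  equal almost everywhere, so the theorem in \<open>L\<^sup>2\<close> supplies the representing vector.
\<close>

theorem hs_Riesz_representation:
  assumes add: "\<And>F G. F \<in> H \<Longrightarrow> G \<in> H \<Longrightarrow> \<phi> (\<lambda>z. F z + G z) = \<phi> F + \<phi> G"
    and scale: "\<And>c F. F \<in> H \<Longrightarrow> \<phi> (\<lambda>z. c * F z) = c * \<phi> F"
    and bounded: "\<And>F. F \<in> H \<Longrightarrow> cmod (\<phi> F) \<le> C * hs_norm \<Omega> \<rho> n F"
  obtains G where "G \<in> H" "\<And>F. F \<in> H \<Longrightarrow> \<phi> F = hs_inner \<Omega> \<rho> n F G"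
proof -
  have norm: "hs_norm \<Omega> \<rho> n (synthesis u) = L2_norm dual_measure u" if u: "u \<in> L2_space dual_measure" for u
  proof -
    have "AE \<xi> in dual_measure. (cmod (analysis (synthesis u) \<xi>))\<^sup>2 = (cmod (u \<xi>))\<^sup>2"
      using analysis_synthesis[OF u] by eventually_elim simp
    then show ?thesis
      unfolding hs_norm_eq L2_norm_def
      using analysis_L2[OF synthesis_in[OF u]] u
      by (intro arg_cong[where f = sqrt] integral_cong_AE borel_measurable_integrable L2_space_sq_integrable)
  qed
  obtain g where g: "g \<in> L2_space dual_measure"
    and \<phi>g: "\<And>u. u \<in> L2_space dual_measure \<Longrightarrow> \<phi> (synthesis u) = L2_inner dual_measure u g"
  proof (rule L2_Riesz_representation[where M = dual_measure and \<phi> = "\<lambda>u. \<phi> (synthesis u)" and C = C])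
    show "cmod (\<phi> (synthesis u)) \<le> C * L2_norm dual_measure u" if "u \<in> L2_space dual_measure" for u
      using bounded[OF synthesis_in[OF that]] norm[OF that] by simp
  qed (use that in \<open>auto simp: synthesis_add synthesis_scale add scale synthesis_in\<close>)
  show thesis
  proof
    show "synthesis g \<in> H" using g by (rule synthesis_in)
    show "\<phi> F = hs_inner \<Omega> \<rho> n F (synthesis g)" if "F \<in> H" for F
      using \<phi>g[OF analysis_L2[OF that]] that g by (simp add: synthesis_analysis hs_inner_synthesis)
  qed
qed

end

section \<open>Carleson measures, the embedding and the sesquilinear form\<close>

lemma holomorphic_several_continuous_on:
  "holomorphic_several F S \<Longrightarrow> continuous_on S F"
  unfolding holomorphic_several_def
  by (intro continuous_at_imp_continuous_on) (auto dest!: has_derivative_continuous)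

context hardy_sobolev_space
begin

context
  fixes \<mu> :: "(complex^'d) measure"
  assumes sets_\<mu>: "sets \<mu> = sets (restrict_space borel (tube \<Omega>))"
begin

lemma H_measurable:
  assumes "F \<in> H"
  shows "F \<in> borel_measurable \<mu>"
proof -
  have "continuous_on (tube \<Omega>) F"
    using assms by (auto simp: hardy_sobolev_def holomorphic_several_continuous_on)
  then have "F \<in> borel_measurable (restrict_space borel (tube \<Omega>))"
    by (rule borel_measurable_continuous_on_restrict)
  then show ?thesis
    using measurable_cong_sets[OF sets_\<mu> refl] by blast
qed

text \<open>
  The common content of the first three conditions.
\<close>

definition embeds :: bool where
  "embeds \<longleftrightarrow> (\<exists>C\<ge>0. \<forall>F\<in>H. F \<in> L2_space \<mu> \<and> L2_norm \<mu> F \<le> C * hs_norm \<Omega> \<rho> n F)"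

lemma carleson_iff_embeds: "carleson \<Omega> \<rho> n \<mu> \<longleftrightarrow> embeds"
proof
  assume "carleson \<Omega> \<rho> n \<mu>"
  then obtain C where C: "0 < C"
    and le: "\<And>F. F \<in> H \<Longrightarrow> (\<integral>\<^sup>+z. ennreal ((cmod (F z))\<^sup>2) \<partial>\<mu>) \<le> ennreal (C * (hs_norm \<Omega> \<rho> n F)\<^sup>2)"
    unfolding carleson_def by blast
  show embeds
    unfolding embeds_def
  proof (intro exI[of _ "sqrt C"] conjI ballI)
    show "0 \<le> sqrt C" using C by simp
    fix F assume F: "F \<in> H"
    have nn: "0 \<le> C * (hs_norm \<Omega> \<rho> n F)\<^sup>2" using C by simp
    note * = L2_norm_via_nn_integral[OF H_measurable[OF F] le[OF F] nn]
    show "F \<in> L2_space \<mu>" by (rule *(1))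
    show "L2_norm \<mu> F \<le> sqrt C * hs_norm \<Omega> \<rho> n F"
      by (rule power2_le_imp_le) (use *(2) C hs_norm_nonneg[of F] in \<open>simp_all add: power_mult_distrib\<close>)
  qed
next
  assume embeds
  then obtain C where C: "0 \<le> C"
    and F: "\<And>F. F \<in> H \<Longrightarrow> F \<in> L2_space \<mu>" "\<And>F. F \<in> H \<Longrightarrow> L2_norm \<mu> F \<le> C * hs_norm \<Omega> \<rho> n F"
    unfolding embeds_def by blast
  show "carleson \<Omega> \<rho> n \<mu>"
    unfolding carleson_def
  proof (intro exI[of _ "C\<^sup>2 + 1"] conjI ballI)
    show "0 < C\<^sup>2 + 1" by (simp add: add_nonneg_pos)
    fix G assume G: "G \<in> H"
    have "(L2_norm \<mu> G)\<^sup>2 \<le> (C * hs_norm \<Omega> \<rho> n G)\<^sup>2"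
      using F(2)[OF G] L2_norm_nonneg by (rule power_mono)
    also have "\<dots> \<le> (C\<^sup>2 + 1) * (hs_norm \<Omega> \<rho> n G)\<^sup>2"
      by (simp add: power_mult_distrib distrib_right)
    finally show "(\<integral>\<^sup>+z. ennreal ((cmod (G z))\<^sup>2) \<partial>\<mu>) \<le> ennreal ((C\<^sup>2 + 1) * (hs_norm \<Omega> \<rho> n G)\<^sup>2)"
      unfolding nn_integral_L2_norm[OF F(1)[OF G]] by (rule ennreal_leI)
  qed
qed

lemma embedding_bounded_iff_embeds:
  "bounded_operator H (hs_norm \<Omega> \<rho> n) (L2_space \<mu>) (L2_norm \<mu>) (\<lambda>F. F) \<longleftrightarrow> embeds"
proof
  assume "bounded_operator H (hs_norm \<Omega> \<rho> n) (L2_space \<mu>) (L2_norm \<mu>) (\<lambda>F. F)"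
  then obtain C where *: "\<And>F. F \<in> H \<Longrightarrow> F \<in> L2_space \<mu>"
      "\<And>F. F \<in> H \<Longrightarrow> L2_norm \<mu> F \<le> C * hs_norm \<Omega> \<rho> n F"
    unfolding bounded_operator_def by blast
  have "L2_norm \<mu> F \<le> \<bar>C\<bar> * hs_norm \<Omega> \<rho> n F" if "F \<in> H" for F
    using *(2)[OF that] mult_right_mono[OF abs_ge_self[of C] hs_norm_nonneg[of F]] by linarith
  with *(1) show embeds
    unfolding embeds_def by (intro exI[of _ "\<bar>C\<bar>"]) simp
qed (auto simp: embeds_def bounded_operator_def)

lemma form_B_eq_L2_inner: "form_B \<mu> F G = L2_inner \<mu> F G"
  by (simp add: form_B_def L2_inner_def)

text \<open>
  On the diagonal, absolute convergence of the integral is square integrability; products of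
  two square integrable functions are in turn integrable by the inequality between geometric and arithmetic mean.
\<close>

lemma form_B_converges_iff: "form_B_converges \<Omega> \<rho> n \<mu> \<longleftrightarrow> H \<subseteq> L2_space \<mu>"
proof
  assume *: "form_B_converges \<Omega> \<rho> n \<mu>"
  show "H \<subseteq> L2_space \<mu>"
  proof
    fix F assume F: "F \<in> H"
    then have "integrable \<mu> (\<lambda>z. Re (F z * cnj (F z)))"
      using * unfolding form_B_converges_def by (intro integrable_Re) blast
    moreover have "Re (F z * cnj (F z)) = (cmod (F z))\<^sup>2" for z
      by (simp only: complex_norm_square[symmetric] Re_complex_of_real)
    ultimately have "integrable \<mu> (\<lambda>z. (cmod (F z))\<^sup>2)" by (simp only:)
    with H_measurable[OF F] show "F \<in> L2_space \<mu>" by (simp add: L2_space_def)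
  qed
next
  assume "H \<subseteq> L2_space \<mu>"
  then show "form_B_converges \<Omega> \<rho> n \<mu>"
    unfolding form_B_converges_def by (auto intro!: L2_space_mult_cnj_integrable)
qed

lemma form_B_bounded_iff_embeds:
  "form_B_converges \<Omega> \<rho> n \<mu> \<and> form_B_bounded \<Omega> \<rho> n \<mu> \<longleftrightarrow> embeds"
proof
  assume *: "form_B_converges \<Omega> \<rho> n \<mu> \<and> form_B_bounded \<Omega> \<rho> n \<mu>"
  then have sub: "H \<subseteq> L2_space \<mu>" by (simp add: form_B_converges_iff)
  from * obtain C where C: "\<And>F G. F \<in> H \<Longrightarrow> G \<in> H \<Longrightarrow>
      cmod (form_B \<mu> F G) \<le> C * hs_norm \<Omega> \<rho> n F * hs_norm \<Omega> \<rho> n G"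
    unfolding form_B_bounded_def by blast
  have "L2_norm \<mu> F \<le> sqrt \<bar>C\<bar> * hs_norm \<Omega> \<rho> n F" if F: "F \<in> H" for F
  proof (rule power2_le_imp_le)
    have "(L2_norm \<mu> F)\<^sup>2 = cmod (form_B \<mu> F F)"
      by (simp only: form_B_eq_L2_inner L2_inner_self norm_of_real abs_power2)
    also have "\<dots> \<le> C * (hs_norm \<Omega> \<rho> n F)\<^sup>2"
      using C[OF F F] by (simp add: power2_eq_square mult.assoc)
    also have "\<dots> \<le> \<bar>C\<bar> * (hs_norm \<Omega> \<rho> n F)\<^sup>2" by (rule mult_right_mono) auto
    finally show "(L2_norm \<mu> F)\<^sup>2 \<le> (sqrt \<bar>C\<bar> * hs_norm \<Omega> \<rho> n F)\<^sup>2" by (simp add: power_mult_distrib)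
  qed (simp add: hs_norm_nonneg)
  with sub show embeds
    unfolding embeds_def by (intro exI[of _ "sqrt \<bar>C\<bar>"]) auto
next
  assume embeds
  then obtain C where C: "0 \<le> C" "\<And>F. F \<in> H \<Longrightarrow> F \<in> L2_space \<mu>"
      "\<And>F. F \<in> H \<Longrightarrow> L2_norm \<mu> F \<le> C * hs_norm \<Omega> \<rho> n F"
    unfolding embeds_def by blast
  have "cmod (form_B \<mu> F G) \<le> C\<^sup>2 * hs_norm \<Omega> \<rho> n F * hs_norm \<Omega> \<rho> n G" if "F \<in> H" "G \<in> H" for F G
  proof -
    have "cmod (form_B \<mu> F G) \<le> L2_norm \<mu> F * L2_norm \<mu> G"
      unfolding form_B_eq_L2_inner using that C(2) by (intro L2_Cauchy_Schwarz)
    also have "\<dots> \<le> (C * hs_norm \<Omega> \<rho> n F) * (C * hs_norm \<Omega> \<rho> n G)"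
      using that C by (intro mult_mono mult_nonneg_nonneg hs_norm_nonneg L2_norm_nonneg)
    finally show ?thesis by (simp add: power2_eq_square ac_simps)
  qed
  then have "form_B_bounded \<Omega> \<rho> n \<mu>" unfolding form_B_bounded_def by blast
  with C(2) show "form_B_converges \<Omega> \<rho> n \<mu> \<and> form_B_bounded \<Omega> \<rho> n \<mu>"
    by (auto simp: form_B_converges_iff)
qed

text \<open>
  Extensionality off the space is included because it makes an operator determined by its values on
  the space a unique function of the logic.
\<close>

definition represents :: "((complex^'d \<Rightarrow> complex) \<Rightarrow> complex^'d \<Rightarrow> complex) \<Rightarrow> bool" where
  "represents T \<longleftrightarrow> T \<in> H \<rightarrow>\<^sub>E H \<and> bounded_operator H (hs_norm \<Omega> \<rho> n) H (hs_norm \<Omega> \<rho> n) T \<and>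
      positive_operator \<Omega> \<rho> n T \<and> (\<forall>F\<in>H. \<forall>G\<in>H. hs_inner \<Omega> \<rho> n (T F) G = form_B \<mu> F G)"

lemma represents_unique:
  assumes "represents T" "represents T'"
  shows "T = T'"
proof (rule PiE_ext)
  show "T \<in> H \<rightarrow>\<^sub>E H" "T' \<in> H \<rightarrow>\<^sub>E H" using assms by (simp_all add: represents_def)
  show "T F = T' F" if "F \<in> H" for F
    using assms that by (intro hs_inner_nondegenerate) (auto simp: represents_def PiE_def Pi_def)
qed

lemma represents_form_B_bounded:
  assumes "represents T"
  shows "form_B_bounded \<Omega> \<rho> n \<mu>"
proof -
  obtain C where C: "\<And>F. F \<in> H \<Longrightarrow> hs_norm \<Omega> \<rho> n (T F) \<le> C * hs_norm \<Omega> \<rho> n F"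
    using assms unfolding represents_def bounded_operator_def by blast
  have T: "T F \<in> H" if "F \<in> H" for F
    using assms that by (auto simp: represents_def PiE_def Pi_def)
  have "cmod (form_B \<mu> F G) \<le> C * hs_norm \<Omega> \<rho> n F * hs_norm \<Omega> \<rho> n G" if "F \<in> H" "G \<in> H" for F G
  proof -
    have "form_B \<mu> F G = hs_inner \<Omega> \<rho> n (T F) G"
      using assms that by (simp add: represents_def)
    also have "cmod \<dots> \<le> hs_norm \<Omega> \<rho> n (T F) * hs_norm \<Omega> \<rho> n G"
      using T that by (intro hs_Cauchy_Schwarz)
    also have "\<dots> \<le> C * hs_norm \<Omega> \<rho> n F * hs_norm \<Omega> \<rho> n G"
      using C that by (intro mult_right_mono hs_norm_nonneg)
    finally show ?thesis .
  qed
  then show ?thesis unfolding form_B_bounded_def by blast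
qed

text \<open>
  For fixed \<open>F\<close> the map \<open>G \<mapsto> form_B \<mu> G F\<close> is linear and bounded, so the Riesz theorem gives the value of the
  operator at \<open>F\<close>. Linearity follows from nondegeneracy of the inner product, boundedness from testing
  with \<open>G = T F\<close>, and positivity from testing with \<open>G = F\<close>. The operator is restricted to the
  space so that it is extensional.
\<close>

lemma form_B_represented:
  assumes conv: "form_B_converges \<Omega> \<rho> n \<mu>" and bdd: "form_B_bounded \<Omega> \<rho> n \<mu>"
  obtains T where "represents T"
proof -
  have L2: "F \<in> L2_space \<mu>" if "F \<in> H" for F
    using conv that by (auto simp: form_B_converges_iff)
  obtain C where C: "\<And>F G. F \<in> H \<Longrightarrow> G \<in> H \<Longrightarrow>
      cmod (form_B \<mu> F G) \<le> C * hs_norm \<Omega> \<rho> n F * hs_norm \<Omega> \<rho> n G"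
    using bdd unfolding form_B_bounded_def by blast
  have "\<exists>K. K \<in> H \<and> (\<forall>G\<in>H. hs_inner \<Omega> \<rho> n K G = form_B \<mu> F G)" if F: "F \<in> H" for F
  proof -
    obtain K where K: "K \<in> H" "\<And>G. G \<in> H \<Longrightarrow> form_B \<mu> G F = hs_inner \<Omega> \<rho> n G K"
    proof (rule hs_Riesz_representation[where \<phi> = "\<lambda>G. form_B \<mu> G F" and C = "C * hs_norm \<Omega> \<rho> n F"])
      show "cmod (form_B \<mu> G F) \<le> C * hs_norm \<Omega> \<rho> n F * hs_norm \<Omega> \<rho> n G" if "G \<in> H" for G
        using C[OF that F] by (simp add: ac_simps)
    qed (use that F L2 in \<open>auto simp: form_B_eq_L2_inner L2_inner_add_left L2_inner_scale_left\<close>)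
    have "hs_inner \<Omega> \<rho> n K G = form_B \<mu> F G" if "G \<in> H" for G
      using K(2)[OF that] hs_inner_commute[of K G] L2_inner_commute[of \<mu> F G]
      by (simp add: form_B_eq_L2_inner)
    with K(1) show ?thesis by blast
  qed
  then obtain S where S: "\<And>F. F \<in> H \<Longrightarrow> S F \<in> H"
      "\<And>F G. F \<in> H \<Longrightarrow> G \<in> H \<Longrightarrow> hs_inner \<Omega> \<rho> n (S F) G = form_B \<mu> F G"
    by metis
  define T where "T = restrict S H"
  have T: "T F \<in> H" "\<And>G. G \<in> H \<Longrightarrow> hs_inner \<Omega> \<rho> n (T F) G = form_B \<mu> F G" if "F \<in> H" for F
    using S that by (auto simp: T_def)
  have "represents T"
    unfolding represents_def bounded_operator_def positive_operator_def
  proof (intro conjI ballI allI)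
    show "T \<in> H \<rightarrow>\<^sub>E H" using S(1) by (simp add: T_def)
    show "T F \<in> H" if "F \<in> H" for F using that by (rule T(1))
    show "T (\<lambda>z. F z + G z) = (\<lambda>z. T F z + T G z)" if "F \<in> H" "G \<in> H" for F G
      using that by (intro hs_inner_nondegenerate)
        (simp_all add: T H_add hs_inner_add_left form_B_eq_L2_inner L2_inner_add_left L2)
    show "T (\<lambda>z. c * F z) = (\<lambda>z. c * T F z)" if "F \<in> H" for c F
      using that by (intro hs_inner_nondegenerate)
        (simp_all add: T H_scale hs_inner_scale_left form_B_eq_L2_inner L2_inner_scale_left)
    show "\<exists>C. \<forall>F\<in>H. hs_norm \<Omega> \<rho> n (T F) \<le> C * hs_norm \<Omega> \<rho> n F"
    proof (intro exI ballI)
      fix F assume F: "F \<in> H"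
      have "(hs_norm \<Omega> \<rho> n (T F))\<^sup>2 = cmod (form_B \<mu> F (T F))"
        by (simp only: T(2)[OF F T(1)[OF F], symmetric] hs_inner_self norm_of_real abs_power2)
      also have "\<dots> \<le> \<bar>C\<bar> * hs_norm \<Omega> \<rho> n F * hs_norm \<Omega> \<rho> n (T F)"
        using C[OF F T(1)[OF F]]
        by (rule order_trans) (intro mult_right_mono hs_norm_nonneg abs_ge_self)
      finally have "hs_norm \<Omega> \<rho> n (T F) * hs_norm \<Omega> \<rho> n (T F)
          \<le> (\<bar>C\<bar> * hs_norm \<Omega> \<rho> n F) * hs_norm \<Omega> \<rho> n (T F)"
        by (simp add: power2_eq_square)
      then show "hs_norm \<Omega> \<rho> n (T F) \<le> \<bar>C\<bar> * hs_norm \<Omega> \<rho> n F"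
        using hs_norm_nonneg[of "T F"] hs_norm_nonneg[of F]
        by (cases "hs_norm \<Omega> \<rho> n (T F) = 0") (simp_all add: mult_le_cancel_right)
    qed
    show "hs_inner \<Omega> \<rho> n (T F) F \<in> \<real>\<^sub>\<ge>\<^sub>0" if F: "F \<in> H" for F
      unfolding T(2)[OF F F] form_B_eq_L2_inner L2_inner_self by (simp del: of_real_power)
    show "hs_inner \<Omega> \<rho> n (T F) G = form_B \<mu> F G" if "F \<in> H" "G \<in> H" for F G
      using that by (rule T(2))
  qed
  then show thesis by (rule that)
qed

lemma form_B_bounded_iff_represented:
  "form_B_converges \<Omega> \<rho> n \<mu> \<and> form_B_bounded \<Omega> \<rho> n \<mu>
    \<longleftrightarrow> form_B_converges \<Omega> \<rho> n \<mu> \<and> (\<exists>!T. represents T)"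
  using form_B_represented represents_unique represents_form_B_bounded by metis

end

end

theorem proposition7p2:
  fixes \<Omega> :: "(real^'d) set" and \<rho> :: "real^'d \<Rightarrow> real" and n :: nat
    and \<mu> :: "(complex^'d) measure"
  assumes "\<Omega> \<noteq> {}" and "open \<Omega>" and "convex \<Omega>"
    and "\<And>x t. x \<in> \<Omega> \<Longrightarrow> 0 < t \<Longrightarrow> t *\<^sub>R x \<in> \<Omega>"
    and "\<not> (\<exists>a v. v \<noteq> 0 \<and> (\<forall>t. a + t *\<^sub>R v \<in> \<Omega>))"
    and "continuous_on (dual_cone \<Omega>) \<rho>"
    and "\<And>\<xi>. \<xi> \<in> dual_cone \<Omega> \<Longrightarrow> 0 \<le> \<rho> \<xi>"
    and "\<And>\<xi>. \<xi> \<in> dual_cone \<Omega> \<Longrightarrow> \<xi> \<noteq> 0 \<Longrightarrow> 0 < \<rho> \<xi>"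
    and "\<And>\<xi> t. \<xi> \<in> dual_cone \<Omega> \<Longrightarrow> 0 < t \<Longrightarrow> \<rho> (t *\<^sub>R \<xi>) = t * \<rho> \<xi>"
    and "sets \<mu> = sets (restrict_space borel (tube \<Omega>))"
  defines "H \<equiv> hardy_sobolev \<Omega> \<rho> n"
  defines "i \<equiv> carleson \<Omega> \<rho> n \<mu>"
  defines "ii \<equiv> bounded_operator H (hs_norm \<Omega> \<rho> n) (L2_space \<mu>) (L2_norm \<mu>) (\<lambda>F. F)"
  defines "iii \<equiv> form_B_converges \<Omega> \<rho> n \<mu> \<and> form_B_bounded \<Omega> \<rho> n \<mu>"
  defines "iv \<equiv> form_B_converges \<Omega> \<rho> n \<mu> \<and>
    (\<exists>!T. T \<in> H \<rightarrow>\<^sub>E H \<and> bounded_operator H (hs_norm \<Omega> \<rho> n) H (hs_norm \<Omega> \<rho> n) T \<and>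
      positive_operator \<Omega> \<rho> n T \<and>
      (\<forall>F\<in>H. \<forall>G\<in>H. hs_inner \<Omega> \<rho> n (T F) G = form_B \<mu> F G))"
  shows "(i \<longleftrightarrow> ii) \<and> (ii \<longleftrightarrow> iii) \<and> (iii \<longleftrightarrow> iv)"
proof -
  interpret hardy_sobolev_space \<Omega> \<rho> n
    using assms(1-4,6) by unfold_locales
  note sets = \<open>sets \<mu> = sets (restrict_space borel (tube \<Omega>))\<close>
  have "i \<longleftrightarrow> embeds \<mu>"
    unfolding i_def using sets by (rule carleson_iff_embeds)
  moreover have "ii \<longleftrightarrow> embeds \<mu>"
    unfolding ii_def H_def using sets by (rule embedding_bounded_iff_embeds)
  moreover have "iii \<longleftrightarrow> embeds \<mu>"
    unfolding iii_def using sets by (rule form_B_bounded_iff_embeds)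
  moreover have "iii \<longleftrightarrow> iv"
    unfolding iii_def iv_def H_def
    using form_B_bounded_iff_represented[OF sets] unfolding represents_def[OF sets] .
  ultimately show ?thesis by blast
qed

end
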